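(* Let $A$ be a unital C*-algebra. Then $A$ has row length at most $2$; moreover, for every $n\in\mathbb{N}$ and every $x\in M_{1,n}(A)$, $$\|x\|_{(2)}\le \inf_{c>\sqrt{2}+1}\left(\frac{\sqrt{2}\,(c^3-1)}{c-\sqrt{2}-1}\right)\|x\|,$$ and the right-hand side is strictly less than $55\|x\|$ whenever $x\neq 0$.
   Context: For a C*-algebra $A$, $M_{m,n}(A)$ carries its usual operator space norm (as a corner of a matrix C*-algebra over $A$), and scalar matrices carry the operator norm. Row length: a unital C*-algebra $A$ has row length at most $d$ if there is a constant $K>0$ such that for every $n\in\mathbb{N}$ and every $x\in M_{1,n}(A)$ there exist $N\in\mathbb{N}$, scalar matrices $C_1\in M_{1,N}(\mathbb{C})$, $C_k\in M_N(\mathbb{C})$ for $2\le k\le d$, $C_{d+1}\in M_{N,n}(\mathbb{C})$, and diagonal matrices $D_1,\dots,D_d\in M_N(A)$ whose diagonal entries lie in the closed unit ball of $A$, such that $$x=C_1D_1C_2D_2\cdots C_dD_dC_{d+1}\quad\text{and}\quad \prod_{i=1}^{d+1}\|C_i\|\le K\|x\|.$$ For $x\in M_{1,n}(A)$, $\|x\|_{(d)}$ denotes the infimum of $\prod_{i=1}^{d+1}\|C_i\|$ over all $N\in\mathbb{N}$ and all factorisations $x=C_1D_1C_2D_2\cdots C_dD_dC_{d+1}$ with scalar matrices $C_1\in M_{1,N}(\mathbb{C})$, $C_k\in M_N(\mathbb{C})$ for $2\le k\le d$, $C_{d+1}\in M_{N,n}(\mathbb{C})$, and diagonal matrices $D_1,\dots,D_d\in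 M_N(A)$ whose diagonal entries lie in the closed unit ball of $A$. *)

theory Defs
  imports Complex_Main "Jordan_Normal_Form.Matrix"
begin

text \<open>
  Unital C*-algebras as a type class. The class \<^class>\<open>real_normed_algebra_1\<close> provides the unit, the
  submultiplicative norm and \<open>norm 1 = 1\<close> (so the zero algebra is excluded), and \<^class>\<open>banach\<close> provides
  completeness. Complex scalars and the involution are added here.
\<close>

class unital_cstar_algebra = real_normed_algebra_1 + banach +
  fixes scaleC :: "complex \<Rightarrow> 'a \<Rightarrow> 'a"  (infixr "*\<^sub>C" 75)
    and star :: "'a \<Rightarrow> 'a"
  assumes scaleC_add_right: "c *\<^sub>C (x + y) = c *\<^sub>C x + c *\<^sub>C y"
    and scaleC_add_left: "(b + c) *\<^sub>C x = b *\<^sub>C x + c *\<^sub>C x"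
    and scaleC_scaleC: "b *\<^sub>C c *\<^sub>C x = (b * c) *\<^sub>C x"
    and scaleR_eq_scaleC: "r *\<^sub>R x = complex_of_real r *\<^sub>C x"
    and mult_scaleC_left: "(c *\<^sub>C x) * y = c *\<^sub>C (x * y)"
    and mult_scaleC_right: "x * (c *\<^sub>C y) = c *\<^sub>C (x * y)"
    and norm_scaleC: "norm (c *\<^sub>C x) = cmod c * norm x"
    and star_star: "star (star x) = x"
    and star_add: "star (x + y) = star x + star y"
    and star_mult: "star (x * y) = star y * star x"
    and star_scaleC: "star (c *\<^sub>C x) = cnj c *\<^sub>C star x"
    and norm_star_mult_self: "norm (star x * x) = (norm x)\<^sup>2"

instantiation complex :: unital_cstar_algebra
begin

definition scaleC_complex :: "complex \<Rightarrow> complex \<Rightarrow> complex" where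
  "scaleC_complex c x = c * x"

definition star_complex :: "complex \<Rightarrow> complex" where
  "star_complex = cnj"

instance
  by standard
    (simp_all add: scaleC_complex_def star_complex_def algebra_simps scaleR_conv_of_real
      norm_mult power2_eq_square)

end

text \<open>
  The norm on \<open>M\<^bsub>m,n\<^esub>(A)\<close>. The C*-algebra \<open>M\<^bsub>k\<^esub>(A)\<close> is the algebra of adjointable operators on the
  Hilbert C*-module \<open>A\<^sup>k\<close>, whose norm is \<open>\<parallel>\<Sum>\<^sub>i a\<^sub>i\<^sup>* a\<^sub>i\<parallel>\<close> to the power \<open>1/2\<close>, and its C*-norm is the operator
  norm. Rectangular matrices are corners, that is, operators \<open>A\<^sup>n \<rightarrow> A\<^sup>m\<close>. On a row this gives
  \<open>\<parallel>\<Sum>\<^sub>i x\<^sub>i x\<^sub>i\<^sup>*\<parallel>\<close> to the power \<open>1/2\<close>. For \<open>A = \<complex>\<close> the column norm is the Euclidean norm on \<open>\<complex>\<^sup>n\<close>, so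
  \<open>mat_norm\<close> is the usual operator norm of a scalar matrix. The supremum is over a nonempty set
  bounded above.
\<close>

definition col_norm :: "'a::unital_cstar_algebra vec \<Rightarrow> real" where
  "col_norm a = sqrt (norm (\<Sum>i<dim_vec a. star (a $ i) * a $ i))"

definition mat_norm :: "'a::unital_cstar_algebra mat \<Rightarrow> real" where
  "mat_norm X = (SUP a \<in> {a \<in> carrier_vec (dim_col X). col_norm a \<le> 1}. col_norm (X *\<^sub>v a))"

definition scalar_mat :: "complex mat \<Rightarrow> 'a::unital_cstar_algebra mat" where
  "scalar_mat = map_mat (\<lambda>c. c *\<^sub>C 1)"

text \<open>\<open>alt_prod C D d\<close> is \<open>C\<^sub>1 D\<^sub>1 C\<^sub>2 D\<^sub>2 \<cdots> C\<^sub>d D\<^sub>d C\<^bsub>d+1\<^esub>\<close>, with indices starting at 1 as in this formula.\<close>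

primrec alt_prod ::
    "(nat \<Rightarrow> complex mat) \<Rightarrow> (nat \<Rightarrow> 'a::unital_cstar_algebra mat) \<Rightarrow> nat \<Rightarrow> 'a mat" where
  "alt_prod C D 0 = scalar_mat (C 1)"
| "alt_prod C D (Suc k) = alt_prod C D k * D (Suc k) * scalar_mat (C (Suc (Suc k)))"

text \<open>Only meaningful for \<open>d \<ge> 1\<close>; \<open>N\<close> is the inner matrix size.\<close>

definition is_factorisation ::
    "nat \<Rightarrow> 'a::unital_cstar_algebra mat \<Rightarrow> nat \<Rightarrow> (nat \<Rightarrow> complex mat) \<Rightarrow> (nat \<Rightarrow> 'a mat) \<Rightarrow> bool" where
  "is_factorisation d x N C D \<longleftrightarrow>
     C 1 \<in> carrier_mat 1 N \<and>
     (\<forall>k\<in>{2..d}. C k \<in> carrier_mat N N) \<and>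
     C (d + 1) \<in> carrier_mat N (dim_col x) \<and>
     (\<forall>k\<in>{1..d}. D k \<in> carrier_mat N N \<and> diagonal_mat (D k) \<and> (\<forall>i<N. norm (D k $$ (i, i)) \<le> 1)) \<and>
     x = alt_prod C D d"

definition row_length_at_most :: "'a::unital_cstar_algebra itself \<Rightarrow> nat \<Rightarrow> bool" where
  "row_length_at_most _ d \<longleftrightarrow>
     (\<exists>K>0. \<forall>n. \<forall>x \<in> (carrier_mat 1 n :: 'a mat set). \<exists>N C D.
        is_factorisation d x N C D \<and> (\<Prod>i=1..d + 1. mat_norm (C i)) \<le> K * mat_norm x)"

text \<open>
  For \<open>d \<ge> 1\<close> every row has a factorisation, so the infimum is over a nonempty set of
  nonnegative reals.
\<close>

definition fact_norm :: "nat \<Rightarrow> 'a::unital_cstar_algebra mat \<Rightarrow> real" where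
  "fact_norm d x = Inf {(\<Prod>i=1..d + 1. mat_norm (C i)) |N C D. is_factorisation d x N C D}"

end

(*
  Write x_k = a_k w_k with a_k the square root of x_k x_k* + delta and w_k a contraction. The random
  sums S = sum_k eps_k a_k over all signs eps are selfadjoint, and E S^4 is bounded by a multiple of
  the square of the norm of sum_k a_k^2; selfadjointness of the a_k is what keeps the noncommutative
  fourth moment under control. Replacing S by the bounded element T = mu (mu + S^2)^(-1) S changes
  the Rademacher coefficients a_k by a row of small norm, by Bessel's inequality. The row
  (E (eps_k T)) w_k is by construction of the form C1 D1 C2 D2 C3, with D1 = diag(T_eps) up to
  scaling, C2 the matrix of signs and D2 = diag(w_k). So every row is the sum of a factorised row of
  norm at most sqrt 3 ||x|| and a row of norm at most ||x|| / 2. Iterating finitely often and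
  factorising the last remainder trivially gives the bound 5 ||x||, well below the infimum in the
  statement.
*)
theory Submission
  imports Defs "HOL-Analysis.Convex" "HOL-Analysis.Elementary_Metric_Spaces"
begin

text \<open>For a general row only the norm of sum_k x_k x_k* is controlled, while the fourth moment
  of sum_k eps_k x_k also involves sum_k x_k* x_k, whose norm can be n times as large. For the
  selfadjoint a_k both sums are the same. With q = ||x||^2 and a suitable delta, sum_k a_k^2 has
  norm at most 2 q, so the averaged fourth moment is at most 3 (2 q)^2 = 12 q^2. Truncation at level
  mu has squared error at most S^4 / (4 mu) and size at most sqrt mu / 2; mu = 12 q turns these into
  q / 4 and sqrt (3 q). A factorisation has finite size N, so the geometric series of corrections
  has to be stopped. The trivial factorisation costs at most a factor n, and n rounds reduce this to
  n / 2^n. Spectral theory is avoided: square roots and inverses are fixed points of contractions,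
  equipped with commutation properties, and operator inequalities are proved by writing the
  difference as a sum of positive terms.\<close>

section \<open>Elementary identities for the involution and the norm\<close>

lemma norm_star: "norm (star x) = norm (x::'a::unital_cstar_algebra)"
proof -
  have *: "norm y \<le> norm (star y)" for y :: 'a
  proof (cases "y = 0")
    case False
    have "norm y * norm y \<le> norm (star y) * norm y"
      using norm_mult_ineq[of "star y" y] norm_star_mult_self[of y] by (simp add: power2_eq_square)
    then show ?thesis using False by simp
  qed simp
  show ?thesis using *[of x] *[of "star x"] by (simp add: star_star)
qed

lemma star_0 [simp]: "star (0::'a::unital_cstar_algebra) = 0"
  using norm_star[of "0::'a"] by simp

lemma star_1 [simp]: "star (1::'a::unital_cstar_algebra) = 1"
  by (metis mult.right_neutral star_mult star_star mult.left_neutral)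

lemma star_scaleR: "star (r *\<^sub>R x) = r *\<^sub>R star (x::'a::unital_cstar_algebra)"
  by (simp add: scaleR_eq_scaleC star_scaleC)

lemma star_minus: "star (- x) = - star (x::'a::unital_cstar_algebra)"
  using star_scaleR[of "-1" x] by simp

lemma star_diff: "star (x - y) = star x - star (y::'a::unital_cstar_algebra)"
  using star_add[of x "- y"] by (simp add: star_minus)

lemma star_of_real [simp]: "star (of_real r :: 'a::unital_cstar_algebra) = of_real r"
  by (simp add: of_real_def star_scaleR)

lemma star_sum: "star (\<Sum>i\<in>I. f i) = (\<Sum>i\<in>I. star (f i :: 'a::unital_cstar_algebra))"
  by (induction I rule: infinite_finite_induct) (auto simp: star_add)

lemma star_power: "star (x ^ n) = star (x::'a::unital_cstar_algebra) ^ n"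
  by (induction n) (auto simp: star_mult power_commutes)

lemmas star_simps = star_star star_add star_diff star_minus star_mult star_scaleR

lemma norm_self_mult_star: "norm (x * star x) = (norm (x::'a::unital_cstar_algebra))\<^sup>2"
  using norm_star_mult_self[of "star x"] by (simp add: star_star norm_star)

lemma norm_selfadj_sq: "star h = h \<Longrightarrow> norm (h * h) = (norm (h::'a::unital_cstar_algebra))\<^sup>2"
  using norm_star_mult_self[of h] by simp

lemma continuous_on_star: "continuous_on S (star :: 'a::unital_cstar_algebra \<Rightarrow> 'a)"
  unfolding continuous_on_iff dist_norm by (metis norm_star star_diff)

lemma of_real_mult_left: "of_real r * x = r *\<^sub>R (x::'a::real_algebra_1)"
  and of_real_mult_right: "x * of_real r = r *\<^sub>R x"
  by (simp_all add: of_real_def)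

lemma norm_of_real_mult: "norm (of_real r * (x::'a::real_normed_algebra_1)) = \<bar>r\<bar> * norm x"
  by (simp add: of_real_def)

section \<open>Positive elements\<close>

text \<open>This norm condition stands in for nonnegativity of the spectrum; it makes the positive elements
  visibly a cone.\<close>
definition pos :: "'a::unital_cstar_algebra \<Rightarrow> bool" where
  "pos h \<longleftrightarrow> star h = h \<and> (\<exists>t. norm (of_real t - h) \<le> t)"

lemma posI: "star h = h \<Longrightarrow> norm (of_real t - h) \<le> t \<Longrightarrow> pos h"
  by (auto simp: pos_def)

lemma pos_star: "pos h \<Longrightarrow> star h = h" by (simp add: pos_def)

lemma posE:
  assumes "pos h" obtains t where "t \<ge> t0" "t > 0" "norm (of_real t - h) \<le> t"
proof -
  from assms obtain t where t: "norm (of_real t - h) \<le> t" by (auto simp: pos_def)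
  define T where "T = max t (max t0 1)"
  have "norm (of_real T - h) \<le> norm (of_real (T - t) :: 'a) + norm (of_real t - h)"
    using norm_triangle_ineq[of "of_real (T-t)" "of_real t - h"] by simp
  also have "\<dots> \<le> T" unfolding norm_of_real using t by (simp add: T_def)
  finally show ?thesis using that[of T] by (auto simp: T_def)
qed

lemma pos_add: assumes "pos a" "pos b" shows "pos (a + b)"
proof -
  from assms(1) obtain t where t: "norm (of_real t - a) \<le> t" by (auto simp: pos_def)
  from assms(2) obtain s where s: "norm (of_real s - b) \<le> s" by (auto simp: pos_def)
  have "norm (of_real (t + s) - (a + b)) \<le> t + s"
    using norm_triangle_ineq[of "of_real t - a" "of_real s - b"] s t by (simp add: algebra_simps)
  then show ?thesis using assms[THEN pos_star] by (intro posI[of _ "t + s"]) (auto simp: star_simps)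
qed

lemma pos_scaleR: assumes "pos a" "r \<ge> 0" shows "pos (r *\<^sub>R a)"
proof -
  from assms(1) obtain t where t: "norm (of_real t - a) \<le> t" by (auto simp: pos_def)
  have "of_real (r * t) - r *\<^sub>R a = r *\<^sub>R (of_real t - a)"
    by (simp add: scaleR_right_diff_distrib of_real_def)
  then have "norm (of_real (r * t) - r *\<^sub>R a) \<le> r * t" using t assms by (simp add: mult_left_mono)
  then show ?thesis using pos_star[OF assms(1)] by (intro posI[of _ "r * t"]) (auto simp: star_simps)
qed

lemma pos_of_real_diff: "star h = h \<Longrightarrow> norm h \<le> \<beta> \<Longrightarrow> pos (of_real \<beta> - h)"
  by (auto simp: pos_def star_simps intro!: exI[of _ \<beta>])

lemma pos_of_real [simp]: "r \<ge> 0 \<Longrightarrow> pos (of_real r)"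
  using pos_of_real_diff[of 0 r] by simp

lemma pos_0 [simp]: "pos 0" using pos_of_real[of 0] by (simp del: pos_of_real)

lemma pos_sum: "(\<And>i. i \<in> I \<Longrightarrow> pos (f i)) \<Longrightarrow> pos (\<Sum>i\<in>I. f i)"
  by (induction I rule: infinite_finite_induct) (auto intro: pos_add)

section \<open>Square roots and inverses as fixed points\<close>

text \<open>Writing \<open>u = 1 - y\<close> turns \<open>u * u = 1 - b\<close> into
  \<open>y = (b + y * y) / 2\<close>, whose right-hand side is a contraction of a ball.
  Selfadjointness and commutation with everything that commutes with \<open>b\<close> are closed
  conditions preserved by this map, so the fixed point has them too. The commutation clause replaces
  functional calculus in what follows.\<close>

lemma sqrt_one_minus:
  fixes b :: "'a::unital_cstar_algebra"
  assumes b: "star b = b" "norm b < 1"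
  obtains u where "star u = u" "u * u = 1 - b" "\<And>c. c * b = b * c \<Longrightarrow> c * u = u * c" "norm (1 - u) < 1"
proof -
  \<comment> \<open>The smaller root of \<open>(norm b + r * r) / 2 = r\<close>: the ball of radius
    \<open>r\<close> is mapped into itself, and \<open>r < 1\<close> is also the Lipschitz constant
    there.\<close>
  define r where "r = 1 - sqrt (1 - norm b)"
  have r: "0 \<le> r" "r < 1" using b by (auto simp: r_def)
  have r2: "(norm b + r * r) / 2 = r"
  proof -
    define q where "q = sqrt (1 - norm b)"
    have "q\<^sup>2 = 1 - norm b" using b by (simp add: q_def)
    then have "norm b = 1 - q * q" by (simp add: power2_eq_square)
    then show ?thesis unfolding r_def q_def[symmetric] by (simp add: field_simps)
  qed
  define C where "C = {c. c * b = b * c}"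
  define S where "S = {y. norm y \<le> r} \<inter> {y. star y = y} \<inter> (\<Inter>c\<in>C. {y. c * y = y * c})"
  define f where "f = (\<lambda>y. (1/2) *\<^sub>R (b + y * y))"
  have "closed S" unfolding S_def
    by (intro closed_Int closed_INT
        ballI closed_Collect_le closed_Collect_eq continuous_intros continuous_on_star)
  then have "complete S" by (simp add: complete_eq_closed)
  moreover have "0 \<in> S" using r by (simp add: S_def)
  then have "S \<noteq> {}" by blast
  moreover have "f ` S \<subseteq> S"
  proof clarify
    fix y assume y: "y \<in> S"
    have "norm (b + y * y) \<le> norm b + norm y * norm y"
      by (rule order_trans[OF norm_triangle_ineq]) (simp add: norm_mult_ineq)
    also have "\<dots> \<le> norm b + r * r" using y r by (intro add_left_mono mult_mono) (auto simp: S_def)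
    finally have "norm (f y) \<le> r" using r2 by (simp add: f_def)
    moreover have "star (f y) = f y" using y b by (simp add: f_def S_def star_simps)
    moreover have "c * f y = f y * c" if "c \<in> C" for c
    proof -
      have cy: "c * y = y * c" "c * b = b * c" using y that by (auto simp: S_def C_def)
      then have "c * (y * y) = y * y * c" by (metis mult.assoc)
      then show ?thesis using cy by (simp add: f_def algebra_simps)
    qed
    ultimately show "f y \<in> S" by (auto simp: S_def)
  qed
  moreover have "dist (f x) (f y) \<le> r * dist x y" if xy: "x \<in> S" "y \<in> S" for x y
  proof -
    have "f x - f y = (1/2) *\<^sub>R (x * (x - y) + (x - y) * y)"
      unfolding f_def scaleR_diff_right[symmetric] by (simp add: algebra_simps)
    then have "norm (f x - f y) \<le> (1/2) * (norm x * norm (x - y) + norm (x - y) * norm y)"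
      by (simp add: norm_triangle_le add_mono norm_mult_ineq)
    also have "\<dots> \<le> (1/2) * (r * norm (x - y) + norm (x - y) * r)"
      using xy by (intro mult_left_mono add_mono mult_right_mono) (auto simp: S_def)
    finally show ?thesis by (simp add: dist_norm)
  qed
  ultimately obtain y where y: "y \<in> S" "f y = y"
    using Banach_fix[of S r f] r by blast
  have "2 *\<^sub>R f y = b + y * y" by (simp add: f_def)
  then have yy: "y + y = b + y * y" using y(2) by (simp add: scaleR_2)
  show thesis
  proof (rule that[of "1 - y"])
    show "star (1 - y) = 1 - y" using y by (simp add: S_def star_simps)
    show "(1 - y) * (1 - y) = 1 - b" using yy by (simp add: algebra_simps)
    show "c * (1 - y) = (1 - y) * c" if "c * b = b * c" for c
      using y that by (auto simp: S_def C_def algebra_simps)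
    show "norm (1 - (1 - y)) < 1" using y r by (simp add: S_def)
  qed
qed

text \<open>If \<open>t\<close> witnesses \<open>pos h\<close> and \<open>T = t + \<delta>\<close>,
  then \<open>h + of_real \<delta>\<close> is \<open>T\<close> times \<open>1 - b\<close>, where
  \<open>b\<close> is \<open>of_real t - h\<close> divided by \<open>T\<close>. The shift by
  \<open>\<delta>\<close> makes \<open>norm b\<close> strictly less than 1; the strict bound on
  \<open>s\<close> is what later makes \<open>s\<close> invertible.\<close>

lemma pos_sqrt:
  fixes h :: "'a::unital_cstar_algebra"
  assumes h: "pos h" and d: "\<delta> > 0"
  obtains s \<rho> where "star s = s" "s * s = h + of_real \<delta>" "\<And>c. c * h = h * c \<Longrightarrow> c * s = s * c"
    "norm (of_real \<rho> - s) < \<rho>"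
proof -
  obtain t where t: "t > 0" "norm (of_real t - h) \<le> t" using posE[OF h, of 0] by blast
  define T where "T = t + \<delta>"
  have T: "T > 0" using t d by (simp add: T_def)
  define b where "b = (1/T) *\<^sub>R (of_real t - h)"
  have "norm b < 1" using t d T by (simp add: b_def T_def)
  moreover have "star b = b" using h by (simp add: b_def star_simps pos_star)
  ultimately obtain u where u: "star u = u" "u * u = 1 - b" "\<And>c. c * b = b * c \<Longrightarrow> c * u = u * c"
      "norm (1 - u) < 1"
    using sqrt_one_minus by metis
  have Tb: "T *\<^sub>R b = of_real t - h" using T by (simp add: b_def)
  show thesis
  proof (rule that[of "sqrt T *\<^sub>R u" "sqrt T"])
    show "star (sqrt T *\<^sub>R u) = sqrt T *\<^sub>R u" by (simp add: star_simps u)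
    have "(sqrt T *\<^sub>R u) * (sqrt T *\<^sub>R u) = T *\<^sub>R (u * u)" using T by simp
    also have "\<dots> = of_real T - T *\<^sub>R b" by (simp add: u of_real_def algebra_simps)
    also have "\<dots> = h + of_real \<delta>" unfolding Tb by (simp add: T_def)
    finally show "(sqrt T *\<^sub>R u) * (sqrt T *\<^sub>R u) = h + of_real \<delta>" .
    show "c * sqrt T *\<^sub>R u = sqrt T *\<^sub>R u * c" if "c * h = h * c" for c
    proof -
      have "c * b = b * c" using that by (simp add: b_def algebra_simps of_real_def)
      then show ?thesis using u(3) by simp
    qed
    have "of_real (sqrt T) - sqrt T *\<^sub>R u = sqrt T *\<^sub>R (1 - u)" by (simp add: of_real_def algebra_simps)
    then show "norm (of_real (sqrt T) - sqrt T *\<^sub>R u) < sqrt T" using T u(4) by simp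
  qed
qed

text \<open>Up to the scalar \<rho>, \<open>s\<close> is \<open>1 - x\<close> with
  \<open>norm x < 1\<close>. The fixed points of \<open>w = 1 + x * w\<close> and
  \<open>v = 1 + v * x\<close>, both sums of the Neumann series, give a right and a left inverse,
  which agree by associativity.\<close>

lemma inverse_exists:
  fixes s :: "'a::unital_cstar_algebra"
  assumes "norm (of_real \<rho> - s) < \<rho>"
  obtains r where "r * s = 1" "s * r = 1" "\<And>c. c * s = s * c \<Longrightarrow> c * r = r * c" "star s = s \<Longrightarrow> star r = r"
proof -
  have \<rho>: "\<rho> > 0" using assms norm_ge_zero less_le_trans le_less_trans by blast
  define x where "x = 1 - (1/\<rho>) *\<^sub>R s"
  have "x = (1/\<rho>) *\<^sub>R (of_real \<rho> - s)" using \<rho> by (simp add: x_def of_real_def algebra_simps)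
  then have x: "norm x < 1" using assms \<rho> by simp
  have "\<exists>!w. 1 + x * w = w"
  proof (rule banach_fix_type[OF _ x], goal_cases)
    case 2
    show ?case using norm_mult_ineq[of x] by (auto simp: dist_norm right_diff_distrib[symmetric])
  qed simp
  then obtain w where w: "1 + x * w = w" by blast
  have "\<exists>!w. 1 + w * x = w"
  proof (rule banach_fix_type[OF _ x], goal_cases)
    case 2
    show ?case using norm_mult_ineq[of _ x]
        by (auto simp: dist_norm left_diff_distrib[symmetric] mult.commute[of "norm x"])
  qed simp
  then obtain v where v: "1 + v * x = v" by blast
  have w1: "s * ((1/\<rho>) *\<^sub>R w) = 1" using w \<rho> by (simp add: x_def algebra_simps)
  have v1: "((1/\<rho>) *\<^sub>R v) * s = 1" using v \<rho> by (simp add: x_def algebra_simps)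
  define r where "r = (1/\<rho>) *\<^sub>R w"
  have r1: "s * r = 1" using w1 by (simp add: r_def)
  then have "r = (1/\<rho>) *\<^sub>R v" by (metis v1 mult.assoc mult_1 mult.right_neutral)
  then have r2: "r * s = 1" using v1 by simp
  show thesis
  proof (rule that[OF r2 r1])
    fix c assume "c * s = s * c"
    then have "r * (c * s) * r = r * (s * c) * r" by simp
    then show "c * r = r * c" using r1 r2 by (metis mult.assoc mult_1 mult.right_neutral)
  next
    assume "star s = s"
    then have "star r * s = 1" using r1 star_mult[of s r] by simp
    then show "star r = r" using r1 by (metis mult.assoc mult_1 mult.right_neutral)
  qed
qed

text \<open>The idea is that \<open>s + \<i> r\<close> is a multiple of a unitary and \<open>s\<close> is its real part.\<close>
lemma norm_le_of_square_sum:
  fixes s r :: "'a::unital_cstar_algebra"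
  assumes "star s = s" "star r = r" "s * r = r * s" "s * s + r * r = of_real \<beta>" "\<beta> \<ge> 0"
  shows "(norm s)\<^sup>2 \<le> \<beta>"
proof -
  define w where "w = s + \<i> *\<^sub>C r"
  have m: "(- \<i>) *\<^sub>C x = - (\<i> *\<^sub>C x)" for x :: 'a
    using scaleC_add_left[of "-\<i>" \<i> x] scaleC_add_left[of 0 0 x] by (simp add: eq_neg_iff_add_eq_0)
  have m1: "(- 1) *\<^sub>C x = - x" for x :: 'a
    using scaleR_eq_scaleC[of "-1" x] by simp
  have sw: "star w = s - \<i> *\<^sub>C r" by (simp add: w_def star_simps star_scaleC assms m)
  have ii: "\<i> *\<^sub>C \<i> *\<^sub>C x = - x" for x :: 'a by (simp add: scaleC_scaleC m1)
  have di: "\<i> *\<^sub>C (x - y) = \<i> *\<^sub>C x - \<i> *\<^sub>C y" for x y :: 'a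
    using scaleC_add_right[of \<i> "x - y" y] by (simp add: algebra_simps)
  have "star w * w = s * s + r * r"
    unfolding sw unfolding w_def
    by (simp add: algebra_simps mult_scaleC_left mult_scaleC_right ii assms(3) di)
  then have "(norm w)\<^sup>2 = \<beta>" using norm_star_mult_self[of w] assms by simp
  moreover have "2 * norm s \<le> norm w + norm (star w)"
  proof -
    have "2 *\<^sub>R s = w + star w" unfolding sw by (simp add: w_def scaleR_2)
    then have "norm (2 *\<^sub>R s) \<le> norm w + norm (star w)" by (simp add: norm_triangle_ineq)
    then show ?thesis by simp
  qed
  ultimately show ?thesis using power_mono[of "norm s" "norm w" 2] by (simp add: norm_star)
qed

section \<open>The order and the norm\<close>

text \<open>After a shift by \<open>d\<close>, both \<open>h\<close> and
  \<open>of_real \<beta> - h\<close> have selfadjoint square roots. These commute, and their squares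
  add up to the scalar \<open>\<beta> + 2 * d\<close>, so \<open>norm_le_of_square_sum\<close>
  bounds the root of \<open>h\<close>.\<close>

lemma norm_le_of_pos:
  fixes h :: "'a::unital_cstar_algebra"
  assumes h: "pos h" "pos (of_real \<beta> - h)" and \<beta>: "\<beta> \<ge> 0"
  shows "norm h \<le> \<beta>"
proof (rule field_le_epsilon)
  fix e :: real assume "e > 0"
  define d where "d = e / 3"
  have d: "d > 0" using \<open>e > 0\<close> by (simp add: d_def)
  obtain s where s: "star s = s" "s * s = h + of_real d" "\<And>c. c * h = h * c \<Longrightarrow> c * s = s * c"
    using pos_sqrt[OF h(1) d] by metis
  obtain r where r: "star r = r" "r * r = of_real \<beta> - h + of_real d"
      "\<And>c. c * (of_real \<beta> - h) = (of_real \<beta> - h) * c \<Longrightarrow> c * r = r * c"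
    using pos_sqrt[OF h(2) d] by metis
  have "h * s = s * h" using s(3) by simp
  then have "s * (of_real \<beta> - h) = (of_real \<beta> - h) * s"
      by (simp add: algebra_simps of_real_mult_left of_real_mult_right)
  then have "s * r = r * s" using r(3) by simp
  moreover have "s * s + r * r = of_real (\<beta> + (d + d))"
  proof -
    have "x + z + (y - x + z) = y + (z + z)" for x y z :: 'a by simp
    then show ?thesis unfolding s(2) r(2) of_real_add .
  qed
  ultimately have "(norm s)\<^sup>2 \<le> \<beta> + 2 * d" using norm_le_of_square_sum[of s r] s(1) r(1) \<beta> d by simp
  then have "norm (h + of_real d) \<le> \<beta> + 2 * d" using s(2) norm_selfadj_sq[OF s(1)] by simp
  moreover have "norm h \<le> norm (h + of_real d) + norm (of_real d :: 'a)"
    by (metis norm_triangle_ineq4 add_diff_cancel_right')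
  ultimately show "norm h \<le> \<beta> + e" using d by (simp add: d_def)
qed

text \<open>Every upper bound of the norm is thus a witness in \<open>pos\<close>: the element
  \<open>of_real t - h\<close> is positive, and so is its complement \<open>h\<close>.\<close>

lemma pos_bound:
  assumes "pos h" "norm h \<le> t" shows "norm (of_real t - h) \<le> t"
  using norm_le_of_pos[of "of_real t - h" t] assms pos_of_real_diff[of h t] pos_star[of h]
    order_trans[OF norm_ge_zero assms(2)] by simp

lemma norm_mono_pos:
  assumes "pos a" "pos (b - a)" shows "norm a \<le> norm b"
proof -
  have "star b = b" using pos_star[OF pos_add[OF assms]] by simp
  then have "pos (of_real (norm b) - b)" by (intro pos_of_real_diff) auto
  from pos_add[OF this assms(2)] show ?thesis using norm_le_of_pos[OF assms(1)] by simp
qed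

text \<open>The norm condition in \<open>pos\<close> is closed once the witness is fixed, and
  \<open>pos_bound\<close> allows a witness controlled by the norm. This removes the shifts that
  \<open>pos_sqrt\<close> introduces.\<close>

lemma pos_limit:
  assumes "star h = h" and "\<And>e. e > 0 \<Longrightarrow> \<exists>g. pos g \<and> norm (g - h) \<le> e"
  shows "pos h"
proof -
  have "norm (of_real (norm h) - h) \<le> norm h"
  proof (rule field_le_epsilon)
    fix e :: real assume e: "e > 0"
    then obtain g where g: "pos g" "norm (g - h) \<le> e / 3" using assms(2)[of "e/3"] by auto
    have gn: "norm g \<le> norm h + e / 3" using norm_triangle_ineq[of h "g - h"] g by simp
    have "of_real (norm h) - h = (of_real (norm h + e/3) - g) + ((g - h) - of_real (e/3))" by simp
    then have "norm (of_real (norm h) - h) \<le> norm (of_real (norm h + e/3) - g) + norm ((g - h)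
        - of_real (e/3))"
      by (metis norm_triangle_ineq)
    also have "\<dots> \<le> (norm h + e/3) + (norm (g - h) + norm (of_real (e/3) :: 'a))"
      by (intro add_mono pos_bound g gn norm_triangle_ineq4)
    also have "\<dots> \<le> norm h + e" unfolding norm_of_real using g e by simp
    finally show "norm (of_real (norm h) - h) \<le> norm h + e" .
  qed
  then show ?thesis using assms by (auto simp: pos_def)
qed

text \<open>Scale \<open>s\<close> so that its square \<open>b\<close> has norm below 1. The root
  \<open>u\<close> of \<open>1 - b\<close> commutes with the scaled \<open>s\<close>, and their
  squares sum to 1; hence \<open>norm (1 - b) = (norm u)\<^sup>2 \<le> 1\<close>, which is the
  witness.\<close>

lemma pos_square: assumes s: "star s = s" shows "pos (s * s)"
proof -
  define N where "N = (norm s)\<^sup>2 + 1"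
  have N: "N > 0" by (simp add: N_def add_nonneg_pos)
  define b where "b = (1/N) *\<^sub>R (s * s)"
  have "norm b < 1" using N norm_selfadj_sq[OF s] by (simp add: b_def N_def)
  moreover have sb: "star b = b" by (simp add: b_def star_simps s)
  ultimately obtain u where u: "star u = u" "u * u = 1 - b" "\<And>c. c * b = b * c \<Longrightarrow> c * u = u * c"
    using sqrt_one_minus by metis
  define s' where "s' = (1 / sqrt N) *\<^sub>R s"
  have s': "s' * s' = b" using N by (simp add: s'_def b_def)
  have "s * u = u * s" by (intro u) (simp add: b_def mult.assoc)
  then have "u * s' = s' * u" by (simp add: s'_def)
  then have "(norm u)\<^sup>2 \<le> 1" using norm_le_of_square_sum[of u s' 1] u(1,2) s' s
    by (simp add: s'_def star_simps)
  then have "norm (1 - b) \<le> 1" using norm_selfadj_sq[OF u(1)] u(2) by simp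
  moreover have "of_real N - s * s = N *\<^sub>R (1 - b)" using N
      by (simp add: b_def of_real_def algebra_simps)
  ultimately have "norm (of_real N - s * s) \<le> N" using N by simp
  then show ?thesis using s by (auto simp: pos_def star_simps)
qed

text \<open>Square roots of \<open>a + of_real d\<close> and \<open>b + of_real d\<close> commute,
  so the product of the shifted elements is a selfadjoint square. It tends to \<open>a * b\<close>
  as \<open>d\<close> tends to 0.\<close>

lemma pos_commuting_mult:
  assumes a: "pos a" and b: "pos b" and ab: "a * b = b * a" shows "pos (a * b)"
proof (rule pos_limit)
  show "star (a * b) = a * b" using pos_star[OF a] pos_star[OF b] ab by (simp add: star_simps)
  fix e :: real assume e: "e > 0"
  \<comment> \<open>The bound \<open>d \<le> 1\<close> absorbs the quadratic error
    \<open>d * d\<close> into the linear one.\<close>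
  define d where "d = min 1 (e / (norm (a + b) + 1))"
  have n1: "norm (a + b) + 1 > 0" by (simp add: add_nonneg_pos)
  have d: "d > 0" "d \<le> 1" "d \<le> e / (norm (a + b) + 1)" using e n1 by (auto simp: d_def)
  obtain s where s: "star s = s" "s * s = a + of_real d" "\<And>c. c * a = a * c \<Longrightarrow> c * s = s * c"
    using pos_sqrt[OF a d(1)] by metis
  obtain r where r: "star r = r" "r * r = b + of_real d" "\<And>c. c * b = b * c \<Longrightarrow> c * r = r * c"
    using pos_sqrt[OF b d(1)] by metis
  have "s * b = b * s" using s(3) ab by metis
  then have sr: "s * r = r * s" using r(3) by simp
  have "(s * r) * (s * r) = (s * s) * (r * r)" by (metis sr mult.assoc)
  also have "\<dots> = a * b + of_real d * (a + b) + of_real (d * d)"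
    unfolding s(2) r(2) by (simp add: algebra_simps of_real_mult_left of_real_mult_right)
  finally have e1: "(s * r) * (s * r) - a * b = of_real d * (a + b) + of_real (d * d)"
      by (simp add: algebra_simps)
  have "norm ((s * r) * (s * r) - a * b) \<le> norm (of_real d * (a + b)) + norm (of_real (d * d) :: 'a)"
    unfolding e1 by (rule norm_triangle_ineq)
  also have "\<dots> \<le> d * norm (a + b) + d * 1"
    unfolding norm_of_real norm_of_real_mult using d by (simp add: mult_left_le)
  also have "\<dots> = d * (norm (a + b) + 1)" by (simp add: algebra_simps)
  also have "\<dots> \<le> e" using d(3) n1 by (simp add: pos_le_divide_eq)
  finally have "norm ((s * r) * (s * r) - a * b) \<le> e" .
  moreover have "pos ((s * r) * (s * r))" by (rule pos_square) (simp add: star_simps s r sr)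
  ultimately show "\<exists>g. pos g \<and> norm (g - a * b) \<le> e" by blast
qed

section \<open>Positivity of \<open>star x * x\<close>\<close>

text \<open>Repeated use of the C*-identity. Together with a growth estimate for powers this serves
  as the spectral radius formula for selfadjoint elements.\<close>

lemma norm_power_selfadj:
  fixes u :: "'a::unital_cstar_algebra"
  assumes "star u = u" shows "norm (u ^ (2 ^ j)) = norm u ^ (2 ^ j)"
proof (induction j)
  case (Suc j)
  have "u ^ (2 ^ Suc j) = u ^ 2 ^ j * u ^ 2 ^ j" by (simp add: power_add[symmetric] mult_2)
  then have "norm (u ^ (2 ^ Suc j)) = (norm (u ^ 2 ^ j))\<^sup>2"
    using norm_selfadj_sq[of "u ^ 2 ^ j"] assms by (simp add: star_power)
  then show ?case by (simp add: Suc power_mult[symmetric] mult.commute)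
qed simp

lemma le_one_of_power_bound:
  fixes q c :: real
  assumes "\<And>j. q ^ (2 ^ j) \<le> 1 + 2 ^ j * c"
  shows "q \<le> 1"
proof (rule ccontr)
  assume q: "\<not> q \<le> 1"
  define p where "p = q - 1"
  have p: "p > 0" using q by (simp add: p_def)
  have "real j * p\<^sup>2 \<le> 2 * c" for j :: nat
  proof -
    define M :: real where "M = 2 ^ j"
    have M: "M > 0" by (simp add: M_def)
    have "1 + M * p \<le> q ^ 2 ^ j" using Bernoulli_inequality[of p "2 ^ j"] p by (simp add: p_def M_def)
    \<comment> \<open>Bernoulli alone grows only linearly, like the assumed bound. Squaring doubles
      the exponent and makes the lower bound quadratic in \<open>M\<close>, while the upper bound
      stays linear.\<close>
    then have "(1 + M * p)\<^sup>2 \<le> (q ^ 2 ^ j)\<^sup>2" using M p by (intro power_mono) auto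
    also have "\<dots> = q ^ 2 ^ Suc j" by (simp add: power_mult[symmetric] mult.commute)
    also have "\<dots> \<le> 1 + 2 * M * c" using assms[of "Suc j"] by (simp add: M_def)
    finally have "M * (M * p\<^sup>2) + 2 * (M * p) \<le> M * (2 * c)"
      by (simp add: power2_eq_square algebra_simps)
    then have "M * (M * p\<^sup>2) \<le> M * (2 * c)" using mult_pos_pos[OF M p] by linarith
    then have "M * p\<^sup>2 \<le> 2 * c" using M by simp
    moreover have "real j * p\<^sup>2 \<le> M * p\<^sup>2"
      unfolding M_def by (intro mult_right_mono) (auto simp: less_imp_le)
    ultimately show ?thesis by simp
  qed
  moreover obtain j :: nat where "real j * p\<^sup>2 > 2 * c" using reals_Archimedean3[of "p\<^sup>2"] p
      by (metis zero_less_power)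
  ultimately show False by (metis not_less)
qed

text \<open>A substitute for the equality of the nonzero spectra of \<open>y\<^sup>* y\<close> and \<open>y y\<^sup>*\<close>. From \<open>u y
    = y v\<close> we get
  \<open>u\<^bsup>N+1\<^esup> = (t - e) u\<^bsup>N\<^esup> + y v\<^bsup>N\<^esup> y\<^sup>*\<close>, so \<open>\<parallel>u\<^bsup>N\<^esup>\<parallel>\<close> grows at most like \<open>N t\<^bsup>N\<^esup>\<close>.\<close>
lemma pos_diff_swap:
  fixes y :: "'a::unital_cstar_algebra"
  assumes e: "e \<ge> 0" and p: "pos (of_real e - star y * y)"
  shows "pos (of_real e - y * star y)"
proof -
  obtain t where t: "t \<ge> e" "t > 0" "norm (of_real t - (of_real e - star y * y)) \<le> t"
    using posE[OF p] by blast
  define v where "v = of_real (t - e) + star y * y"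
  define u where "u = of_real (t - e) + y * star y"
  have v: "norm v \<le> t" using t(3) by (simp add: v_def algebra_simps)
  have su: "star u = u" by (simp add: u_def star_simps)
  have uy: "u * y = y * v" by (simp add: u_def v_def algebra_simps of_real_mult_left of_real_mult_right)
  have uNy: "u ^ N * y = y * v ^ N" for N
  proof (induction N)
    case (Suc N)
    have "u ^ Suc N * y = u * (u ^ N * y)" by (simp add: mult.assoc)
    also have "\<dots> = (u * y) * v ^ N" by (simp add: Suc mult.assoc)
    finally show ?case by (simp add: uy mult.assoc)
  qed simp
  define C where "C = (norm y)\<^sup>2"
  have vN: "norm (v ^ N) \<le> t ^ N" for N
    by (rule order_trans[OF norm_power_ineq]) (simp add: power_mono v)
  have step: "norm (u ^ Suc N) \<le> t * norm (u ^ N) + C * t ^ N" for N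
  proof -
    have Xu: "X * u = X * of_real (t - e) + (X * y) * star y" for X
      by (simp only: u_def distrib_left mult.assoc)
    have "u ^ Suc N = u ^ N * u" by (simp add: power_commutes)
    also have "\<dots> = u ^ N * of_real (t - e) + (u ^ N * y) * star y"
      by (rule Xu)
    also have "\<dots> = of_real (t - e) * u ^ N + y * v ^ N * star y"
      unfolding uNy by (simp only: of_real_mult_left of_real_mult_right)
    finally have "norm (u ^ Suc N) \<le> norm (of_real (t - e) * u ^ N) + norm (y * v ^ N * star y)"
      by (metis norm_triangle_ineq)
    moreover have "norm (of_real (t - e) * u ^ N) \<le> t * norm (u ^ N)"
      unfolding norm_of_real_mult using t e by (intro mult_right_mono) auto
    moreover have "norm (y * v ^ N * star y) \<le> C * t ^ N"
    proof -
      have "norm (y * v ^ N * star y) \<le> norm (y * v ^ N) * norm y"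
        using norm_mult_ineq[of "y * v ^ N" "star y"] by (simp add: norm_star)
      also have "\<dots> \<le> (norm y * norm (v ^ N)) * norm y" by (intro mult_right_mono norm_mult_ineq) auto
      also have "\<dots> \<le> (norm y * t ^ N) * norm y" by (intro mult_right_mono mult_left_mono vN) auto
      finally show ?thesis by (simp add: C_def power2_eq_square mult_ac)
    qed
    ultimately show ?thesis by linarith
  qed
  have bd: "norm (u ^ N) \<le> t ^ N * (1 + N * (C / t))" for N
  proof (induction N)
    case (Suc N)
    have "norm (u ^ Suc N) \<le> t * (t ^ N * (1 + N * (C / t))) + C * t ^ N"
      using step[of N] mult_left_mono[OF Suc, of t] t by linarith
    also have "\<dots> = t ^ Suc N * (1 + Suc N * (C / t))" using t by (simp add: field_simps)
    finally show ?case .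
  qed simp
  have "norm u / t \<le> 1"
  proof (rule le_one_of_power_bound)
    fix j :: nat
    have "norm u ^ 2 ^ j \<le> t ^ (2 ^ j) * (1 + 2 ^ j * (C / t))"
      using bd[of "2 ^ j"] norm_power_selfadj[OF su, of j] by simp
    then show "(norm u / t) ^ 2 ^ j \<le> 1 + 2 ^ j * (C / t)"
      using t by (simp add: power_divide field_simps)
  qed
  then have "norm u \<le> t" using t by simp
  then have "norm (of_real t - (of_real e - y * star y)) \<le> t" by (simp add: u_def algebra_simps)
  then show ?thesis by (auto simp: pos_def star_simps)
qed

text \<open>\<open>p\<close> and \<open>q\<close> are, up to sign, twice the real and imaginary
  parts of \<open>y\<close>, and half the sum of their squares is the element in question.\<close>

lemma star_mult_add_mult_star:
  fixes y :: "'a::unital_cstar_algebra"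
  shows "pos (star y * y + y * star y)"
proof -
  define p where "p = y + star y"
  define q where "q = \<i> *\<^sub>C (y - star y)"
  have m: "(- \<i>) *\<^sub>C x = - (\<i> *\<^sub>C x)" for x :: 'a
    using scaleC_add_left[of "-\<i>" \<i> x] scaleC_add_left[of 0 0 x] by (simp add: eq_neg_iff_add_eq_0)
  have m1: "(- 1) *\<^sub>C x = - x" for x :: 'a
    using scaleR_eq_scaleC[of "-1" x] by simp
  have n: "\<i> *\<^sub>C (- x) = - (\<i> *\<^sub>C x)" for x :: 'a
    using scaleC_add_right[of "\<i>" x "- x"] scaleC_add_right[of \<i> 0 "0::'a"]
        by (simp add: eq_neg_iff_add_eq_0 add.commute)
  have sp: "star p = p" by (simp add: p_def star_simps add.commute)
  have sq: "star q = q"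
    unfolding q_def star_scaleC star_diff star_star using m n[of "y - star y"] by simp
  have qq: "q * q = - ((y - star y) * (y - star y))"
    unfolding q_def by (simp add: mult_scaleC_left mult_scaleC_right scaleC_scaleC m1)
  have "pos ((1/2) *\<^sub>R (p * p + q * q))" by (intro pos_scaleR pos_add pos_square sp sq) simp
  also have "p * p + q * q = 2 *\<^sub>R (star y * y + y * star y)"
    unfolding qq by (simp add: p_def algebra_simps scaleR_2)
  finally show ?thesis by simp
qed

text \<open>With \<open>m\<close> close to the absolute value of \<open>h = x\<^sup>* x\<close>, the element \<open>n = m - h\<close> is close to twice the
  negative part, and \<open>(x n)\<^sup>* (x n)\<close> is nearly negative, which forces \<open>n\<close> to be small.\<close>
theorem pos_star_mult_self:
  fixes x :: "'a::unital_cstar_algebra"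
  shows "pos (star x * x)"
proof (rule pos_limit)
  define h where "h = star x * x"
  have sh: "star h = h" by (simp add: h_def star_simps)
  then show "star (star x * x) = star x * x" by (simp add: h_def)
  fix e :: real assume e: "e > 0"
  \<comment> \<open>The final estimate is
    \<open>(norm n)\<^sup>2 \<le> 4 * d\<^sup>2\<close>.\<close>
  define d where "d = e / 2"
  have d: "d > 0" using e by (simp add: d_def)
  obtain m \<rho> where m: "star m = m" "m * m = h * h + of_real (d\<^sup>2)"
     "\<And>c. c * (h * h) = (h * h) * c \<Longrightarrow> c * m = m * c" "norm (of_real \<rho> - m) < \<rho>"
    using pos_sqrt[OF pos_square[OF sh], of "d\<^sup>2"] d by (metis zero_less_power)
  have pm: "pos m" using m(1,4) by (intro posI[of _ \<rho>]) auto
  obtain r where r: "r * m = 1" "m * r = 1" "\<And>c. c * m = m * c \<Longrightarrow> c * r = r * c" "star r = r"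
    using inverse_exists[OF m(4)] m(1) by metis
  have hm: "h * m = m * h" by (intro m) (simp add: mult.assoc)
  \<comment> \<open>The inverse is \<open>m * (r * r)\<close>, a product of commuting positive
    elements.\<close>
  have pr: "pos r"
  proof -
    have mrr: "m * (r * r) = r" "r * r * m = r"
        by (simp_all add: r(1,2) mult.assoc[of r r] mult.assoc[of m r r, symmetric])
    then have "pos (m * (r * r))" by (intro pos_commuting_mult pm pos_square r(4)) simp
    then show ?thesis by (simp only: mrr)
  qed
  define n where "n = m - h"
  have sn: "star n = n" by (simp add: n_def star_simps m sh)
  have nm: "n * m = m * n" using hm by (simp add: n_def algebra_simps)
  have n1: "n * (m + h) = of_real (d\<^sup>2)" using m(2) hm by (simp add: n_def algebra_simps)
  have n2: "n * n + of_real (d\<^sup>2) = 2 *\<^sub>R (n * m)"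
  proof -
    have "n * n + n * (m + h) = 2 *\<^sub>R (n * m)" by (simp add: n_def algebra_simps scaleR_2)
    then show ?thesis by (simp add: n1)
  qed
  \<comment> \<open>By \<open>n2\<close>, \<open>n\<close> is half of
    \<open>(n * n + of_real (d\<^sup>2)) * r\<close>, again a product of commuting positive
    elements.\<close>
  have pn: "pos n"
  proof -
    have nr: "n * r = r * n" using r(3) nm by simp
    have "pos ((n * n + of_real (d\<^sup>2)) * r)"
    proof (rule pos_commuting_mult[OF pos_add[OF pos_square[OF sn] pos_of_real] pr])
      have "n * n * r = r * (n * n)" using nr by (metis mult.assoc)
      then show "(n * n + of_real (d\<^sup>2)) * r = r * (n * n + of_real (d\<^sup>2))"
        by (simp add: algebra_simps of_real_mult_left of_real_mult_right del: of_real_power)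
    qed simp
    then have "pos ((1/2) *\<^sub>R ((2 *\<^sub>R (n * m)) * r))" unfolding n2 by (intro pos_scaleR) auto
    moreover have "(1/2) *\<^sub>R ((2 *\<^sub>R (n * m)) * r) = n" using r(2) by (simp add: mult.assoc)
    ultimately show ?thesis by simp
  qed
  define n3 where "n3 = n * n * n"
  have pn3: "pos n3" unfolding n3_def
      by (intro pos_commuting_mult pos_square sn pn) (simp add: mult.assoc)
  define k where "k = n * h * n"
  have k2: "2 *\<^sub>R k = d\<^sup>2 *\<^sub>R n - n3"
  proof -
    have "2 *\<^sub>R k + n3 = n * (m + h) * n" by (simp add: k_def n3_def n_def algebra_simps scaleR_2)
    also have "\<dots> = d\<^sup>2 *\<^sub>R n" unfolding n1 by (simp add: scaleR_conv_of_real)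
    finally show ?thesis by (simp add: algebra_simps)
  qed
  define y where "y = x * n"
  have ky: "star y * y = k" by (simp add: y_def k_def h_def star_simps sn mult.assoc)
  define \<epsilon> where "\<epsilon> = d\<^sup>2 * norm n / 2"
  have \<epsilon>: "\<epsilon> \<ge> 0" by (simp add: \<epsilon>_def)
  have kh: "k = (1/2) *\<^sub>R (d\<^sup>2 *\<^sub>R n - n3)" using k2
      by (metis scaleR_scaleR divide_self_if mult.commute times_divide_eq_right mult_1 scaleR_one
          zero_neq_numeral)
  have "of_real \<epsilon> - k = (d\<^sup>2 / 2) *\<^sub>R (of_real (norm n) - n) + (1/2) *\<^sub>R n3"
    unfolding kh \<epsilon>_def by (simp add: of_real_def algebra_simps)
  then have pk: "pos (of_real \<epsilon> - k)" by (auto intro!: pos_add pos_scaleR pos_of_real_diff pn3 sn)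
  \<comment> \<open>So far \<open>k = star y * y\<close> is at most \<epsilon>. The swap gives the
    same upper bound for \<open>y * star y\<close>, and since the sum of the two is positive,
    \<open>k\<close> is also at least -\<epsilon>. Being small from both sides, \<open>k\<close>
    forces the cube \<open>n3\<close> to be small.\<close>
  then have "pos (of_real \<epsilon> - y * star y)" using pos_diff_swap[of \<epsilon> y] \<epsilon> ky by simp
  from pos_add[OF this star_mult_add_mult_star[of y]] have pk': "pos (of_real \<epsilon> + k)" by (simp add: ky)
  have "norm (of_real \<epsilon> + k) \<le> \<epsilon> + \<epsilon>"
    by (rule norm_le_of_pos[OF pk']) (use pk \<epsilon> in \<open>simp_all only: of_real_add
        add_diff_cancel_left add_nonneg_nonneg\<close>)
  then have nk: "norm k \<le> 3 * \<epsilon>"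
    using norm_triangle_ineq4[of "of_real \<epsilon> + k" "of_real \<epsilon>"] \<epsilon> by simp
  have "n3 = d\<^sup>2 *\<^sub>R n - 2 *\<^sub>R k" using k2 by simp
  then have "norm n3 \<le> d\<^sup>2 * norm n + 2 * norm k"
    using norm_triangle_ineq4[of "d\<^sup>2 *\<^sub>R n" "2 *\<^sub>R k"] by simp
  also have "\<dots> \<le> 4 * d\<^sup>2 * norm n" using nk by (simp add: \<epsilon>_def mult_ac)
  finally have n3: "norm n3 \<le> 4 * d\<^sup>2 * norm n" .
  have nn: "norm n \<le> e"
  proof (cases "norm n = 0")
    case False
    have "norm (n * n * (n * n)) = ((norm n)\<^sup>2)\<^sup>2"
      using norm_selfadj_sq[of "n * n"] norm_selfadj_sq[OF sn] by (simp add: star_simps sn)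
    moreover have "norm (n * n * (n * n)) \<le> norm n3 * norm n"
      unfolding n3_def mult.assoc[symmetric] by (rule norm_mult_ineq)
    moreover have "norm n3 * norm n \<le> 4 * d\<^sup>2 * norm n * norm n" by (rule mult_right_mono[OF n3]) simp
    ultimately have "(norm n)\<^sup>2 * (norm n)\<^sup>2 \<le> (4 * d\<^sup>2) * (norm n)\<^sup>2"
      by (simp add: power2_eq_square mult.assoc)
    then have "(norm n)\<^sup>2 \<le> 4 * d\<^sup>2" by (rule mult_right_le_imp_le) (use False in simp)
    then have "(norm n)\<^sup>2 \<le> e\<^sup>2" by (simp add: d_def power_divide)
    then show ?thesis using e by (simp add: power2_le_iff_abs_le)
  qed (use e in simp)
  then have "pos m \<and> norm (m - star x * x) \<le> e" using pm by (simp add: n_def h_def)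
  then show "\<exists>g. pos g \<and> norm (g - star x * x) \<le> e" by blast
qed

lemma pos_mult_star_self: "pos (x * star x)" for x :: "'a::unital_cstar_algebra"
  using pos_star_mult_self[of "star x"] by (simp add: star_star)

text \<open>With \<open>s\<close> a square root of \<open>h + of_real d\<close>, the element
  \<open>(c * s) * star (c * s)\<close> is positive and differs from \<open>c * h * star c\<close>
  by \<open>d\<close> times \<open>c * star c\<close>.\<close>

lemma pos_conj:
  fixes h c :: "'a::unital_cstar_algebra"
  assumes h: "pos h" shows "pos (c * h * star c)"
proof (rule pos_limit)
  show "star (c * h * star c) = c * h * star c" using pos_star[OF h] by (simp add: star_simps mult.assoc)
  fix e :: real assume e: "e > 0"
  define d where "d = e / ((norm c)\<^sup>2 + 1)"
  have c1: "(norm c)\<^sup>2 + 1 > 0" by (simp add: add_nonneg_pos)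
  have d: "d > 0" using e c1 by (simp add: d_def)
  obtain s where s: "star s = s" "s * s = h + of_real d" using pos_sqrt[OF h d] by metis
  have e1: "c * s * star (c * s) = c * h * star c + of_real d * (c * star c)"
  proof -
    have "c * s * star (c * s) = c * (s * s) * star c" by (simp add: star_mult s(1) mult.assoc)
    then show ?thesis unfolding s(2)
        by (simp add: distrib_left distrib_right of_real_mult_left of_real_mult_right)
  qed
  then have "norm (c * s * star (c * s) - c * h * star c) = d * (norm c)\<^sup>2"
    using d by (simp add: norm_of_real_mult norm_self_mult_star)
  also have "\<dots> \<le> e" using e c1 by (simp add: d_def field_simps)
  finally show "\<exists>g. pos g \<and> norm (g - c * h * star c) \<le> e" using pos_mult_star_self by blast
qed

section \<open>Random signs\<close>

text \<open>An exact polar decomposition need not exist inside a C*-algebra. The shift by \<delta>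
  makes \<open>a\<close> invertible, so \<open>w\<close> is the inverse \<open>r\<close> times
  \<open>x\<close>, and \<open>1 - w * star w\<close> is \<delta> times the square of
  \<open>r\<close>, which makes \<open>w\<close> a contraction.\<close>

lemma row_polar:
  fixes x :: "'a::unital_cstar_algebra"
  assumes "\<delta> > 0"
  obtains a w where "star a = a" "a * a = x * star x + of_real \<delta>" "x = a * w" "norm w \<le> 1"
proof -
  obtain a \<rho> where a: "star a = a" "a * a = x * star x + of_real \<delta>" "norm (of_real \<rho> - a) < \<rho>"
    using pos_sqrt[OF pos_mult_star_self[of x] assms] by metis
  obtain r where r: "r * a = 1" "a * r = 1" "star r = r" using inverse_exists[OF a(3)] a(1) by metis
  define w where "w = r * x"
  have "w * star w = r * (x * star x) * r" by (simp add: w_def star_simps r(3) mult.assoc)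
  also have "x * star x = a * a - of_real \<delta>" using a(2) by simp
  also have "r * (a * a - of_real \<delta>) * r = (r * a) * (a * r) - \<delta> *\<^sub>R (r * r)"
    by (simp add: algebra_simps of_real_mult_left of_real_mult_right)
  finally have "1 - w * star w = \<delta> *\<^sub>R (r * r)" by (simp add: r(1,2))
  then have "pos (of_real 1 - w * star w)" using pos_scaleR[OF pos_square[OF r(3)]] assms by simp
  then have "norm (w * star w) \<le> 1" using norm_le_of_pos[OF pos_mult_star_self] by (metis zero_le_one)
  then have "norm w \<le> 1" using power2_le_iff_abs_le[of 1 "norm w"] by (simp add: norm_self_mult_star)
  moreover have "x = a * w" by (simp add: w_def r(2) mult.assoc[symmetric])
  ultimately show thesis using that a by blast
qed

section \<open>Rademacher sums and their fourth moment\<close>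

text \<open>A choice of \<open>n\<close> signs is coded as the subset of \<open>{..<n}\<close> where
  the sign is positive, so expectations are sums over \<open>Pow {..<n}\<close> divided by
  \<open>2 ^ n\<close>.\<close>

definition eps :: "nat set \<Rightarrow> nat \<Rightarrow> real" where
  "eps A k = (if k \<in> A then 1 else - 1)"

text \<open>For distinct indices, toggling the membership of \<open>j\<close> is an involution of
  the power set that flips \<open>eps A j\<close> and fixes \<open>eps A k\<close>.\<close>

lemma eps_orthogonal:
  assumes "j < n" "k < n"
  shows "(\<Sum>A\<in>Pow {..<n}. eps A j * eps A k) = (if j = k then 2 ^ n else 0)"
proof (cases "j = k")
  case True
  have "(\<Sum>A\<in>Pow {..<n}. eps A j * eps A k) = (\<Sum>A\<in>Pow {..<n}. 1)"
    by (intro sum.cong) (auto simp: eps_def True)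
  then show ?thesis using True by (simp add: card_Pow)
next
  case False
  define f where "f A = (if j \<in> A then A - {j} else insert j A)" for A
  have "(\<Sum>A\<in>Pow {..<n}. eps A j * eps A k) = (\<Sum>A\<in>Pow {..<n}. - (eps A j * eps A k))"
    by (rule sum.reindex_bij_witness[of _ f f])
      (use False assms in \<open>auto simp: f_def eps_def split: if_splits\<close>)
  then show ?thesis using False by (simp add: sum_negf)
qed

lemma sum_Pow_Suc:
  fixes f :: "nat set \<Rightarrow> 'a::comm_monoid_add"
  shows "(\<Sum>A\<in>Pow {..<Suc n}. f A) = (\<Sum>A\<in>Pow {..<n}. f A + f (insert n A))"
proof -
  have "inj_on (insert n) (Pow {..<n})"
    by (auto simp: inj_on_def)
  moreover have "Pow {..<n} \<inter> insert n ` Pow {..<n} = {}" by auto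
  ultimately show ?thesis
    by (simp add: lessThan_Suc Pow_insert sum.union_disjoint sum.reindex sum.distrib)
qed

definition rademacher_sum :: "nat \<Rightarrow> (nat \<Rightarrow> 'a::real_vector) \<Rightarrow> nat set \<Rightarrow> 'a" where
  "rademacher_sum n a A = (\<Sum>k<n. eps A k *\<^sub>R a k)"

lemma rademacher_sum_Suc:
  assumes "A \<in> Pow {..<n}"
  shows "rademacher_sum (Suc n) a A = rademacher_sum n a A - a n"
    and "rademacher_sum (Suc n) a (insert n A) = rademacher_sum n a A + a n"
proof -
  have n: "n \<notin> A" using assms by auto
  then show "rademacher_sum (Suc n) a A = rademacher_sum n a A - a n"
    by (simp add: rademacher_sum_def eps_def)
  have "(\<Sum>k<n. eps (insert n A) k *\<^sub>R a k) = (\<Sum>k<n. eps A k *\<^sub>R a k)"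
    by (intro sum.cong) (auto simp: eps_def)
  then show "rademacher_sum (Suc n) a (insert n A) = rademacher_sum n a A + a n"
    by (simp add: rademacher_sum_def eps_def)
qed

lemma sum_eps_rademacher_sum:
  assumes "k < n"
  shows "(\<Sum>A\<in>Pow {..<n}. eps A k *\<^sub>R rademacher_sum n a A) = 2 ^ n *\<^sub>R a k"
proof -
  have "(\<Sum>A\<in>Pow {..<n}. eps A k *\<^sub>R rademacher_sum n a A)
      = (\<Sum>j<n. (\<Sum>A\<in>Pow {..<n}. eps A k * eps A j) *\<^sub>R a j)"
    unfolding rademacher_sum_def scaleR_sum_right scaleR_sum_left scaleR_scaleR by (rule sum.swap)
  also have "\<dots> = (\<Sum>j<n. if j = k then 2 ^ n *\<^sub>R a j else 0)"
    using assms by (intro sum.cong) (auto simp: eps_orthogonal)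
  finally show ?thesis using assms by simp
qed

text \<open>The middle factor \<open>c\<close> is needed for the mixed terms of the fourth moment;
  \<open>c = 1\<close> gives the second moment.\<close>

lemma sum_rademacher_sandwich:
  fixes u v :: "nat \<Rightarrow> 'a::real_algebra_1"
  shows "(\<Sum>A\<in>Pow {..<n}. rademacher_sum n u A * c * rademacher_sum n v A)
      = 2 ^ n *\<^sub>R (\<Sum>k<n. u k * c * v k)"
proof -
  have "(\<Sum>A\<in>Pow {..<n}. rademacher_sum n u A * c * rademacher_sum n v A)
     = (\<Sum>A\<in>Pow {..<n}. \<Sum>k<n. u k * c * (eps A k *\<^sub>R rademacher_sum n v A))"
    by (intro sum.cong) (simp_all add: rademacher_sum_def[of n u] sum_distrib_right)
  also have "\<dots> = (\<Sum>k<n. u k * c * (\<Sum>A\<in>Pow {..<n}. eps A k *\<^sub>R rademacher_sum n v A))"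
    unfolding sum_distrib_left by (rule sum.swap)
  also have "\<dots> = (\<Sum>k<n. u k * c * (2 ^ n *\<^sub>R v k))"
    by (intro sum.cong) (simp_all add: sum_eps_rademacher_sum)
  finally show ?thesis by (simp add: scaleR_sum_right)
qed

lemma star_rademacher_sum: "star (rademacher_sum n a A) = rademacher_sum n (\<lambda>k. star (a k)) A"
  by (simp add: rademacher_sum_def star_sum star_simps)

lemma sum_rademacher_square:
  fixes u v :: "nat \<Rightarrow> 'a::real_algebra_1"
  shows "(\<Sum>A\<in>Pow {..<n}. rademacher_sum n u A * rademacher_sum n v A) = 2 ^ n *\<^sub>R (\<Sum>k<n. u k * v k)"
  using sum_rademacher_sandwich[of n u 1 v] by simp

text \<open>The terms \<open>S c S c + c S c S\<close> are dominated by \<open>S c\<^sup>2 S + c S\<^sup>2 c\<close>.\<close>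
lemma fourth_power_identity:
  fixes S c :: "'a::real_algebra_1"
  defines "E \<equiv> S * c - c * S"
  shows "(S - c) * (S - c) * ((S - c) * (S - c)) + (S + c) * (S + c) * ((S + c) * (S + c)) =
    2 *\<^sub>R (S * S * (S * S) + c * c * (c * c) + S * S * (c * c) + c * c * (S * S)
        + 2 *\<^sub>R (S * (c * c) * S) + 2 *\<^sub>R (c * (S * S) * c)) - 2 *\<^sub>R (E * (c * S - S * c))"
  unfolding E_def by (simp add: algebra_simps scaleR_2)

text \<open>The noncommutative form of the scalar inequality E S^4 \<le> 3 (sum a_k^2)^2. The bound
  is chosen so that the induction closes: averaging over the last sign, all mixed terms of
  \<open>fourth_power_identity\<close> reappear exactly in the increment of the bound. What is left
  over is a multiple of the fourth power of the new coefficient and the squares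
  \<open>E A * star (E A)\<close> of the commutators, all positive.\<close>

lemma rademacher_fourth_moment:
  fixes a :: "nat \<Rightarrow> 'a::unital_cstar_algebra"
  assumes sa: "\<And>k. star (a k) = a k"
  defines "Q \<equiv> \<lambda>n. \<Sum>k<n. a k * a k" and "S \<equiv> \<lambda>n. rademacher_sum n a"
  shows "pos (2 ^ n *\<^sub>R (Q n * Q n + 2 *\<^sub>R (\<Sum>k<n. a k * Q n * a k))
      - (\<Sum>A\<in>Pow {..<n}. S n A * S n A * (S n A * S n A)))"
proof (induction n)
  case 0
  show ?case by (simp add: Q_def S_def rademacher_sum_def)
next
  case (Suc n)
  define c where "c = a n"
  have sc: "star c = c" by (simp add: c_def sa)
  have sS: "star (S n A) = S n A" for A by (simp add: S_def star_rademacher_sum sa)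
  define P where "P = Pow {..<n}"
  define E where "E A = S n A * c - c * S n A" for A
  have sE: "star (E A) = c * S n A - S n A * c" for A by (simp add: E_def star_simps sS sc)
  define F where "F = (\<Sum>A\<in>P. S n A * S n A * (S n A * S n A))"
  have cardP: "card P = 2 ^ n" by (simp add: P_def card_Pow)
  have m0: "(\<Sum>A\<in>P. S n A * S n A) = 2 ^ n *\<^sub>R Q n"
    unfolding P_def S_def Q_def by (rule sum_rademacher_square)
  have m1: "(\<Sum>A\<in>P. S n A * (c * c) * S n A) = 2 ^ n *\<^sub>R (\<Sum>k<n. a k * (c * c) * a k)"
    unfolding P_def S_def by (rule sum_rademacher_sandwich)
  have m2: "(\<Sum>A\<in>P. S n A * S n A * (c * c)) = 2 ^ n *\<^sub>R (Q n * (c * c))"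
    unfolding sum_distrib_right[symmetric] m0 by simp
  have m3: "(\<Sum>A\<in>P. c * c * (S n A * S n A)) = 2 ^ n *\<^sub>R (c * c * Q n)"
    unfolding sum_distrib_left[symmetric] m0 by simp
  have m4: "(\<Sum>A\<in>P. c * (S n A * S n A) * c) = 2 ^ n *\<^sub>R (c * Q n * c)"
    unfolding sum_distrib_right[symmetric] sum_distrib_left[symmetric] m0 by simp
  have m5: "(\<Sum>A\<in>P. c * c * (c * c)) = 2 ^ n *\<^sub>R (c * c * (c * c))"
    by (simp add: cardP of_nat_power scaleR_conv_of_real)
  have "(\<Sum>A\<in>Pow {..<Suc n}. S (Suc n) A * S (Suc n) A * (S (Suc n) A * S (Suc n) A))
     = (\<Sum>A\<in>P. 2 *\<^sub>R (S n A * S n A * (S n A * S n A) + c * c * (c * c) + S n A * S n A * (c * c)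
         + c * c * (S n A * S n A)
        + 2 *\<^sub>R (S n A * (c * c) * S n A) + 2 *\<^sub>R (c * (S n A * S n A) * c)) - 2 *\<^sub>R (E A * star (E A)))"
    unfolding sum_Pow_Suc P_def[symmetric]
  proof (rule sum.cong[OF refl])
    fix A assume "A \<in> P"
    then have *: "S (Suc n) A = S n A - c" "S (Suc n) (insert n A) = S n A + c"
      unfolding S_def c_def P_def by (rule rademacher_sum_Suc)+
    show "S (Suc n) A * S (Suc n) A * (S (Suc n) A * S (Suc n) A)
        + S (Suc n) (insert n A) * S (Suc n) (insert n A) *
       (S (Suc n) (insert n A) * S (Suc n) (insert n A)) =
       2 *\<^sub>R (S n A * S n A * (S n A * S n A) + c * c * (c * c) + S n A * S n A * (c * c)
           + c * c * (S n A * S n A)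
        + 2 *\<^sub>R (S n A * (c * c) * S n A) + 2 *\<^sub>R (c * (S n A * S n A) * c)) - 2 *\<^sub>R (E A * star (E A))"
      unfolding * sE unfolding E_def by (rule fourth_power_identity)
  qed
  also have "\<dots> = 2 *\<^sub>R (F + 2 ^ n *\<^sub>R (c * c * (c * c)) + 2 ^ n *\<^sub>R (Q n * (c * c))
      + 2 ^ n *\<^sub>R (c * c * Q n)
        + 2 *\<^sub>R (2 ^ n *\<^sub>R (\<Sum>k<n. a k * (c * c) * a k)) + 2 *\<^sub>R (2 ^ n *\<^sub>R (c * Q n * c)))
            - 2 *\<^sub>R (\<Sum>A\<in>P. E A * star (E A))"
    unfolding sum_subtractf scaleR_sum_right[symmetric] sum.distrib m1 m2 m3 m4 m5 F_def ..
  finally have F': "(\<Sum>A\<in>Pow {..<Suc n}. S (Suc n) A * S (Suc n) A * (S (Suc n) A * S (Suc n) A)) = \<dots>" .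
  have Q': "Q (Suc n) = Q n + c * c" by (simp add: Q_def c_def)
  have W: "(\<Sum>k<Suc n. a k * Q (Suc n) * a k) = (\<Sum>k<n. a k * Q n * a k) + (\<Sum>k<n. a k * (c * c) * a k)
      + c * Q n * c + c * c * (c * c)"
    unfolding Q' by (simp add: c_def[symmetric] algebra_simps sum.distrib)
  have dbl: "(2 * r) *\<^sub>R v = r *\<^sub>R v + r *\<^sub>R v" "(4 * r) *\<^sub>R v = r *\<^sub>R v + r *\<^sub>R v + r *\<^sub>R v
      + r *\<^sub>R v" for r and v :: 'a
    unfolding scaleR_left_distrib[symmetric] by simp_all
  have "2 ^ Suc n *\<^sub>R (Q (Suc n) * Q (Suc n) + 2 *\<^sub>R (\<Sum>k<Suc n. a k * Q (Suc n) * a k))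
      - (\<Sum>A\<in>Pow {..<Suc n}. S (Suc n) A * S (Suc n) A * (S (Suc n) A * S (Suc n) A))
    = 2 *\<^sub>R (2 ^ n *\<^sub>R (Q n * Q n + 2 *\<^sub>R (\<Sum>k<n. a k * Q n * a k)) - F)
      + (2 * (2 * 2 ^ n)) *\<^sub>R (c * c * (c * c)) + 2 *\<^sub>R (\<Sum>A\<in>P. E A * star (E A))"
    unfolding F' W unfolding Q' by (simp add: algebra_simps scaleR_2 dbl)
  moreover have "pos (2 *\<^sub>R (2 ^ n *\<^sub>R (Q n * Q n + 2 *\<^sub>R (\<Sum>k<n. a k * Q n * a k)) - F)
      + (2 * (2 * 2 ^ n)) *\<^sub>R (c * c * (c * c)) + 2 *\<^sub>R (\<Sum>A\<in>P. E A * star (E A)))"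
  proof (intro pos_add pos_scaleR pos_sum pos_mult_star_self)
    show "pos (2 ^ n *\<^sub>R (Q n * Q n + 2 *\<^sub>R (\<Sum>k<n. a k * Q n * a k)) - F)" using Suc
        by (simp only: F_def P_def)
    show "pos (c * c * (c * c))" by (rule pos_square) (simp add: star_simps sc)
  qed auto
  ultimately show ?case by simp
qed

text \<open>One \<open>q\<^sup>2\<close> comes from \<open>Q * Q\<close> and two from the sandwich:
  \<open>Q\<close> is at most \<open>q\<close>, and conjugating by the selfadjoint
  \<open>a k\<close> and summing bounds the sandwich by \<open>q\<close> times the same
  \<open>Q\<close>.\<close>

lemma rademacher_fourth_moment_bound:
  fixes a :: "nat \<Rightarrow> 'a::unital_cstar_algebra"
  assumes sa: "\<And>k. star (a k) = a k" and q: "norm (\<Sum>k<n. a k * a k) \<le> q"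
  shows "pos (of_real (3 * q\<^sup>2 * 2 ^ n) - (\<Sum>A\<in>Pow {..<n}.
     rademacher_sum n a A * rademacher_sum n a A * (rademacher_sum n a A * rademacher_sum
         n a A)))" (is "pos (_ - ?F)")
proof -
  define Q where "Q = (\<Sum>k<n. a k * a k)"
  have q0: "q \<ge> 0" using q norm_ge_zero order_trans by blast
  have sQ: "star Q = Q" by (simp add: Q_def star_sum star_simps sa)
  have pQ: "pos (of_real q - Q)" using q sQ by (intro pos_of_real_diff) (simp_all add: Q_def)
  have 1: "pos (of_real (q\<^sup>2) - Q * Q)"
    using q norm_selfadj_sq[OF sQ]
        by (intro pos_of_real_diff) (simp_all add: star_simps sQ Q_def[symmetric] power_mono)
  have 2: "pos (\<Sum>k<n. a k * (of_real q - Q) * a k)"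
    using pos_conj[OF pQ, of "a _"] by (intro pos_sum) (simp add: sa)
  have 3: "(\<Sum>k<n. a k * (of_real q - Q) * a k) = q *\<^sub>R Q - (\<Sum>k<n. a k * Q * a k)"
    by (simp add: algebra_simps of_real_mult_right of_real_mult_left sum_subtractf Q_def[symmetric]
        scaleR_sum_right[symmetric])
  have 6: "pos (2 ^ n *\<^sub>R (Q * Q + 2 *\<^sub>R (\<Sum>k<n. a k * Q * a k)) - ?F)"
    unfolding Q_def by (rule rademacher_fourth_moment[OF sa])
  have c5: "of_real (3 * q\<^sup>2 * 2 ^ n) = 2 ^ n *\<^sub>R (of_real (q\<^sup>2) + 2 *\<^sub>R (q *\<^sub>R of_real q) :: 'a)"
    unfolding of_real_def scaleR_scaleR scaleR_right_distrib scaleR_left_distrib[symmetric]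
    by (simp add: power2_eq_square algebra_simps)
  have 5: "of_real (3 * q\<^sup>2 * 2 ^ n) - ?F = 2 ^ n *\<^sub>R ((of_real (q\<^sup>2) - Q * Q)
      + 2 *\<^sub>R (q *\<^sub>R (of_real q - Q) + (q *\<^sub>R Q - (\<Sum>k<n. a k * Q * a k))))
       + (2 ^ n *\<^sub>R (Q * Q + 2 *\<^sub>R (\<Sum>k<n. a k * Q * a k)) - ?F)"
    unfolding c5 by (simp add: algebra_simps)
  show ?thesis unfolding 5
    by (intro pos_add pos_scaleR 1 pQ q0 2[unfolded 3] 6) auto
qed

section \<open>Truncation and the approximation step\<close>

text \<open>\<open>T\<close> is the value at \<open>S\<close> of the function f(t) = \<mu> t /
  (\<mu> + t^2). Both claims come from 4 \<mu> t^2 \<le> (\<mu> + t^2)^2: f(t)^2 \<le> \<mu> / 4,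
  and (t - f(t))^2 = t^6 / (\<mu> + t^2)^2 \<le> t^4 / (4 \<mu>).\<close>

lemma truncation:
  fixes S :: "'a::unital_cstar_algebra"
  assumes sS: "star S = S" and mu: "\<mu> > 0"
  obtains T where "norm T \<le> sqrt \<mu> / 2" "pos ((1 / (4 * \<mu>)) *\<^sub>R (S * S * (S * S)) - (S
      - T) * star (S - T))"
proof -
  define H where "H = S * S"
  have sH: "star H = H" and pH: "pos H" using sS by (auto simp: H_def star_simps intro: pos_square)
  define G where "G = of_real \<mu> + H"
  have "norm (of_real (\<mu> + norm H) - G) < \<mu> + norm H"
    using pos_bound[OF pH order_refl] mu by (simp add: G_def)
  then obtain R where R: "R * G = 1" "G * R = 1" "\<And>c. c * G = G * c \<Longrightarrow> c * R = R * c" "star G = G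
      \<Longrightarrow> star R = R"
    using inverse_exists by metis
  have sR: "star R = R" by (rule R(4)) (simp add: G_def star_simps sH)
  have SG: "S * G = G * S" by (simp add: G_def H_def algebra_simps of_real_mult_left of_real_mult_right)
  have SR: "S * R = R * S" using R(3)[OF SG] .
  have HG: "H * G = G * H" by (simp add: G_def algebra_simps of_real_mult_left of_real_mult_right)
  have HR: "H * R = R * H" using R(3)[OF HG] .
  \<comment> \<open>\<open>X\<close> corresponds to (\<mu> - t^2) / (\<mu> + t^2). Its square is the
    defect in the scalar inequality, so both estimates become positivity of expressions built from
    \<open>X * star X\<close>.\<close>
  define X where "X = R * (of_real \<mu> - H)"
  have sX: "star X = (of_real \<mu> - H) * R" by (simp add: X_def star_simps sR sH)
  have XX: "X * star X = 1 - (4 * \<mu>) *\<^sub>R (R * H * R)"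
  proof -
    have "(of_real \<mu> - H) * (of_real \<mu> - H) = G * G - (4 * \<mu>) *\<^sub>R H"
    proof -
      have "(4 * \<mu>) *\<^sub>R H = \<mu> *\<^sub>R H + \<mu> *\<^sub>R H + \<mu> *\<^sub>R H + \<mu> *\<^sub>R H"
        unfolding scaleR_left_distrib[symmetric] by simp
      then show ?thesis by (simp add: G_def algebra_simps of_real_mult_left of_real_mult_right)
    qed
    moreover have "X * star X = R * ((of_real \<mu> - H) * (of_real \<mu> - H)) * R"
      unfolding sX unfolding X_def by (simp only: mult.assoc)
    ultimately have "X * star X = R * (G * G - (4 * \<mu>) *\<^sub>R H) * R" by (simp only:)
    also have "\<dots> = (R * G) * (G * R) - (4 * \<mu>) *\<^sub>R (R * H * R)" by (simp add: algebra_simps)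
    finally show ?thesis by (simp add: R(1,2))
  qed
  define T where "T = \<mu> *\<^sub>R (R * S)"
  have TT: "T * star T = (\<mu> * \<mu>) *\<^sub>R (R * H * R)"
    by (simp add: T_def star_simps sR sS H_def mult.assoc)
  have "of_real (\<mu> / 4) - T * star T = (\<mu> / 4) *\<^sub>R (X * star X)"
    unfolding TT XX of_real_def by (simp add: algebra_simps)
  then have "pos (of_real (\<mu> / 4) - T * star T)" using mu by (auto intro: pos_scaleR pos_mult_star_self)
  then have "norm (T * star T) \<le> \<mu> / 4" using norm_le_of_pos[OF pos_mult_star_self] mu
      by (metis divide_nonneg_nonneg less_imp_le zero_le_numeral)
  then have "(norm T)\<^sup>2 \<le> (sqrt \<mu> / 2)\<^sup>2" using mu by (simp add: norm_self_mult_star power_divide)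
  then have n: "norm T \<le> sqrt \<mu> / 2" using mu by (intro power2_le_imp_le[of "norm T"]) auto
  have "S = R * G * S" by (simp add: R)
  then have ST: "S - T = R * H * S"
    by (simp add: T_def G_def algebra_simps of_real_mult_left of_real_mult_right)
  have "(S - T) * star (S - T) = R * H * (S * S) * H * R"
    unfolding ST by (simp add: star_simps sR sS sH mult.assoc)
  also have "\<dots> = H * (R * H * R) * H" using HR
      by (simp add: H_def[symmetric] mult.assoc[symmetric]) (metis HR mult.assoc)
  finally have E: "(S - T) * star (S - T) = H * (R * H * R) * H" .
  have "(1 / (4 * \<mu>)) *\<^sub>R (S * S * (S * S)) - (S - T) * star (S - T)
      = (1 / (4 * \<mu>)) *\<^sub>R (H * (X * star X) * star H)"
    unfolding E XX sH H_def[symmetric] using mu by (simp add: algebra_simps)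
  moreover have "pos \<dots>" using mu by (intro pos_scaleR pos_conj pos_mult_star_self) auto
  ultimately show thesis using n that by metis
qed

text \<open>\<open>Z\<close> is the projection of \<open>D\<close> to the span of the signs. All of
  \<open>D * star Z\<close>, \<open>Z * star D\<close> and \<open>Z * star Z\<close> have the same
  average \<open>B\<close>, so the difference in the claim is the average of
  \<open>(D - Z) * star (D - Z)\<close>.\<close>

lemma bessel:
  fixes D :: "nat set \<Rightarrow> 'a::unital_cstar_algebra" and n :: nat
  defines "r \<equiv> \<lambda>k. (1 / 2 ^ n) *\<^sub>R (\<Sum>A\<in>Pow {..<n}. eps A k *\<^sub>R D A)"
  shows "pos ((1 / 2 ^ n) *\<^sub>R (\<Sum>A\<in>Pow {..<n}. D A * star (D A)) - (\<Sum>k<n. r k * star (r k)))"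
proof -
  define P where "P = Pow {..<n}"
  define Z where "Z = rademacher_sum n r"
  have e: "(\<Sum>A\<in>P. eps A k *\<^sub>R D A) = 2 ^ n *\<^sub>R r k" for k by (simp add: r_def P_def)
  have e': "(\<Sum>A\<in>P. eps A k *\<^sub>R star (D A)) = 2 ^ n *\<^sub>R star (r k)" for k
    using arg_cong[OF e[of k], of star] by (simp add: star_sum star_simps)
  have sZ: "star (Z A) = rademacher_sum n (\<lambda>k. star (r k)) A" for A
      by (simp add: Z_def star_rademacher_sum)
  define B where "B = (\<Sum>k<n. r k * star (r k))"
  have 1: "(\<Sum>A\<in>P. Z A * star (Z A)) = 2 ^ n *\<^sub>R B"
    unfolding sZ B_def unfolding Z_def P_def by (rule sum_rademacher_square)
  have 2: "(\<Sum>A\<in>P. D A * star (Z A)) = 2 ^ n *\<^sub>R B"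
  proof -
    have "(\<Sum>A\<in>P. D A * star (Z A)) = (\<Sum>A\<in>P. \<Sum>k<n. (eps A k *\<^sub>R D A) * star (r k))"
      unfolding sZ rademacher_sum_def by (simp add: sum_distrib_left)
    also have "\<dots> = (\<Sum>k<n. (\<Sum>A\<in>P. eps A k *\<^sub>R D A) * star (r k))"
      unfolding sum_distrib_right by (rule sum.swap)
    finally show ?thesis unfolding e by (simp add: B_def scaleR_sum_right)
  qed
  have 3: "(\<Sum>A\<in>P. Z A * star (D A)) = 2 ^ n *\<^sub>R B"
  proof -
    have "(\<Sum>A\<in>P. Z A * star (D A)) = (\<Sum>A\<in>P. \<Sum>k<n. r k * (eps A k *\<^sub>R star (D A)))"
      unfolding Z_def rademacher_sum_def by (simp add: sum_distrib_right)
    also have "\<dots> = (\<Sum>k<n. r k * (\<Sum>A\<in>P. eps A k *\<^sub>R star (D A)))"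
      unfolding sum_distrib_left by (rule sum.swap)
    finally show ?thesis unfolding e' by (simp add: B_def scaleR_sum_right)
  qed
  have "(\<Sum>A\<in>P. (D A - Z A) * star (D A - Z A)) = (\<Sum>A\<in>P. D A * star (D A)) - (\<Sum>A\<in>P. D A * star (Z A))
     - (\<Sum>A\<in>P. Z A * star (D A)) + (\<Sum>A\<in>P. Z A * star (Z A))"
    unfolding sum_subtractf[symmetric] sum.distrib[symmetric]
        by (intro sum.cong) (simp_all add: star_simps algebra_simps)
  then have eq: "(\<Sum>A\<in>P. (D A - Z A) * star (D A - Z A)) = (\<Sum>A\<in>P. D A * star (D A)) - 2 ^ n *\<^sub>R B"
    unfolding 1 2 3 by simp
  have "(1 / 2 ^ n) *\<^sub>R (\<Sum>A\<in>P. D A * star (D A)) - B = (1 / 2 ^ n) *\<^sub>R (\<Sum>A\<in>P. (D A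
      - Z A) * star (D A - Z A))"
    unfolding eq by (simp add: algebra_simps)
  moreover have "pos ((1 / 2 ^ n) *\<^sub>R (\<Sum>A\<in>P. (D A - Z A) * star (D A - Z A)))"
    by (intro pos_scaleR pos_sum pos_mult_star_self) simp
  ultimately show ?thesis by (simp add: P_def B_def)
qed

lemma approximation_step:
  fixes x :: "nat \<Rightarrow> 'a::unital_cstar_algebra"
  assumes q: "q > 0" and x: "norm (\<Sum>k<n. x k * star (x k)) \<le> q"
  obtains T w z where "\<And>A. norm (T A) \<le> sqrt (3 * q)" "\<And>k. norm (w k) \<le> 1"
    "\<And>k. k < n \<Longrightarrow> x k = (1 / 2 ^ n) *\<^sub>R (\<Sum>A\<in>Pow {..<n}. eps A k *\<^sub>R T A) * w k + z k"
    "norm (\<Sum>k<n. z k * star (z k)) \<le> q / 4"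
proof -
  \<comment> \<open>The \<open>n\<close> shifts add up to at most \<open>q\<close>, so regularising
    at most doubles the bound on the row.\<close>
  define \<delta> where "\<delta> = q / (real n + 1)"
  have d: "\<delta> > 0" using q by (simp add: \<delta>_def)
  have "\<exists>a w. star a = a \<and> a * a = x k * star (x k) + of_real \<delta> \<and> x k = a * w \<and> norm w \<le> 1" for k
    using row_polar[OF d, of "x k"] by metis
  then obtain a w where a: "\<And>k. star (a k) = a k" "\<And>k. a k * a k = x k * star (x k) + of_real \<delta>"
     "\<And>k. x k = a k * w k" and w: "\<And>k. norm (w k) \<le> 1" by metis
  have "norm (\<Sum>k<n. a k * a k) \<le> norm (\<Sum>k<n. x k * star (x k)) + norm (of_real (real n * \<delta>) :: 'a)"
    unfolding a(2) sum.distrib by (rule order_trans[OF norm_triangle_ineq]) simp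
  also have "\<dots> \<le> 2 * q"
  proof -
    have "real n * \<delta> \<le> q" using q by (simp add: \<delta>_def field_simps)
    then show ?thesis unfolding norm_of_real using x d by simp
  qed
  finally have Q: "norm (\<Sum>k<n. a k * a k) \<le> 2 * q" .
  define S where "S = rademacher_sum n a"
  have sS: "star (S A) = S A" for A by (simp add: S_def star_rademacher_sum a)
  have "\<exists>T. norm T \<le> sqrt (12 * q) / 2 \<and> pos ((1 / (4 * (12 * q))) *\<^sub>R (S A * S A * (S A * S A))
      - (S A - T) * star (S A - T))" for A
    using truncation[OF sS[of A], of "12 * q"] q by (metis mult_pos_pos zero_less_numeral)
  then obtain T where T: "\<And>A. norm (T A) \<le> sqrt (12 * q) / 2"
     "\<And>A. pos ((1 / (4 * (12 * q))) *\<^sub>R (S A * S A * (S A * S A)) - (S A - T A) * star (S A - T A))"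
         by metis
  have sq: "sqrt (12 * q) / 2 = sqrt (3 * q)"
    using real_sqrt_mult[of 4 "3 * q"] by simp
  define P where "P = Pow {..<n}"
  define D where "D A = S A - T A" for A
  define r where "r k = (1 / 2 ^ n) *\<^sub>R (\<Sum>A\<in>P. eps A k *\<^sub>R D A)" for k
  define z where "z k = r k * w k" for k
  define F where "F = (\<Sum>A\<in>P. S A * S A * (S A * S A))"
  have p1: "pos ((1 / 2 ^ n) *\<^sub>R (\<Sum>A\<in>P. D A * star (D A)) - (\<Sum>k<n. r k * star (r k)))"
    unfolding r_def P_def by (rule bessel)
  have p2: "pos ((1 / (4 * (12 * q))) *\<^sub>R F - (\<Sum>A\<in>P. D A * star (D A)))"
    unfolding F_def scaleR_sum_right sum_subtractf[symmetric] D_def by (intro pos_sum T)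
  have p3: "pos (of_real (3 * (2 * q)\<^sup>2 * 2 ^ n) - F)"
    unfolding F_def P_def S_def by (rule rademacher_fourth_moment_bound[OF a(1) Q])
  \<comment> \<open>Multiplying the row \<open>r\<close> entrywise on the right by contractions does
    not enlarge its sum of \<open>r k * star (r k)\<close>.\<close>
  have p4: "pos (\<Sum>k<n. r k * (of_real 1 - w k * star (w k)) * star (r k))"
    using w by (intro pos_sum
        pos_conj pos_of_real_diff) (simp_all add: star_simps norm_self_mult_star power_le_one)
  have p4': "(\<Sum>k<n. r k * (of_real 1 - w k * star (w k)) * star (r k)) = (\<Sum>k<n. r k * star (r k))
      - (\<Sum>k<n. z k * star (z k))"
    unfolding sum_subtractf[symmetric] z_def by (intro sum.cong) (simp_all add: star_simps algebra_simps)
  \<comment> \<open>A telescoping sum of the four inequalities \<open>p4\<close>, \<open>p1\<close>,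
    \<open>p2\<close>, \<open>p3\<close>; the constants match because 3 (2 q)^2 / (4 * 12 q) = q /
    4.\<close>
  have "of_real (q / 4) - (\<Sum>k<n. z k * star (z k)) =
     ((\<Sum>k<n. r k * star (r k)) - (\<Sum>k<n. z k * star (z k)))
     + ((1 / 2 ^ n) *\<^sub>R (\<Sum>A\<in>P. D A * star (D A)) - (\<Sum>k<n. r k * star (r k)))
     + (1 / 2 ^ n) *\<^sub>R ((1 / (4 * (12 * q))) *\<^sub>R F - (\<Sum>A\<in>P. D A * star (D A)))
     + (1 / 2 ^ n * (1 / (4 * (12 * q)))) *\<^sub>R (of_real (3 * (2 * q)\<^sup>2 * 2 ^ n) - F)"
  proof -
    have "(1 / 2 ^ n * (1 / (4 * (12 * q)))) * (3 * (2 * q)\<^sup>2 * 2 ^ n) = q / 4"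
      using q by (simp add: power2_eq_square field_simps)
    then have "(1 / 2 ^ n * (1 / (4 * (12 * q)))) *\<^sub>R of_real (3 * (2 * q)\<^sup>2 * 2 ^ n)
        = (of_real (q / 4) :: 'a)"
      unfolding of_real_def scaleR_scaleR by simp
    then show ?thesis unfolding scaleR_right_diff_distrib by simp
  qed
  moreover have "pos \<dots>"
    using q by (intro pos_add pos_scaleR p1 p2 p3 p4[unfolded p4']) auto
  ultimately have "pos (of_real (q / 4) - (\<Sum>k<n. z k * star (z k)))" by (simp only:)
  then have zn: "norm (\<Sum>k<n. z k * star (z k)) \<le> q / 4"
    using q by (intro norm_le_of_pos pos_sum pos_mult_star_self) auto
  have xk: "x k = (1 / 2 ^ n) *\<^sub>R (\<Sum>A\<in>P. eps A k *\<^sub>R T A) * w k + z k" if k: "k < n" for k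
  proof -
    have "a k = (1 / 2 ^ n) *\<^sub>R (\<Sum>A\<in>P. eps A k *\<^sub>R S A)"
      unfolding S_def P_def sum_eps_rademacher_sum[OF k] by simp
    also have "\<dots> = (1 / 2 ^ n) *\<^sub>R (\<Sum>A\<in>P. eps A k *\<^sub>R T A) + r k"
      unfolding r_def D_def scaleR_add_right[symmetric] sum.distrib[symmetric] by simp
    finally show ?thesis by (simp add: a(3)[of k] z_def algebra_simps)
  qed
  show thesis
    by (rule that[OF _ w _ zn]) (use T(1) sq xk P_def in auto)
qed

section \<open>Factorisations of rows\<close>

lemma scaleC_zero [simp]: "c *\<^sub>C 0 = (0::'a::unital_cstar_algebra)" "0 *\<^sub>C x = (0::'a)"
  using scaleC_add_right[of c 0 "0::'a"] scaleC_add_left[of 0 0 x] by simp_all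

lemma scaleC_one [simp]: "1 *\<^sub>C x = (x::'a::unital_cstar_algebra)"
  using scaleR_eq_scaleC[of 1 x] by simp

text \<open>The factors are normalised to \<open>\<parallel>C\<^sub>1\<parallel>, \<parallel>C\<^sub>3\<parallel> \<le> \<surd>t\<close> and \<open>\<parallel>C\<^sub>2\<parallel> \<le> 1\<close>, so that direct sums of
  factorisations add up the bounds \<open>t\<close>. The matrix \<open>C\<^sub>2\<close> may be rectangular; it is padded with zeros
  at the end.\<close>
definition is_row_fact where
  "is_row_fact n x t N M c\<^sub>1 c\<^sub>2 c\<^sub>3 d\<^sub>1 d\<^sub>2 \<longleftrightarrow>
     (\<forall>i<N::nat. norm (d\<^sub>1 i :: 'a::unital_cstar_algebra) \<le> 1) \<and> (\<forall>j<M::nat. norm (d\<^sub>2 j) \<le> 1) \<and>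
     (\<forall>k<n::nat. x k = (\<Sum>i<N. \<Sum>j<M. (c\<^sub>1 i * c\<^sub>2 i j * c\<^sub>3 j k) *\<^sub>C (d\<^sub>1 i * d\<^sub>2 j))) \<and>
     (\<Sum>i<N. (cmod (c\<^sub>1 i))\<^sup>2) \<le> t \<and>
     (\<forall>v. (\<Sum>i<N. (cmod (\<Sum>j<M. c\<^sub>2 i j * v j))\<^sup>2) \<le> (\<Sum>j<M. (cmod (v j))\<^sup>2)) \<and>
     (\<forall>v. (\<Sum>j<M. (cmod (\<Sum>k<n. c\<^sub>3 j k * v k))\<^sup>2) \<le> t * (\<Sum>k<n. (cmod (v k))\<^sup>2))"

definition row_fact :: "nat \<Rightarrow> (nat \<Rightarrow> 'a::unital_cstar_algebra) \<Rightarrow> real \<Rightarrow> bool" where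
  "row_fact n x t \<longleftrightarrow> (\<exists>N M c\<^sub>1 c\<^sub>2 c\<^sub>3 d\<^sub>1 d\<^sub>2. is_row_fact n x t N M c\<^sub>1 c\<^sub>2 c\<^sub>3 d\<^sub>1 d\<^sub>2)"

lemma is_row_factD:
  assumes "is_row_fact n x t N M c\<^sub>1 c\<^sub>2 c\<^sub>3 d\<^sub>1 d\<^sub>2"
  shows "\<And>i. i < N \<Longrightarrow> norm (d\<^sub>1 i) \<le> 1" "\<And>j. j < M \<Longrightarrow> norm (d\<^sub>2 j) \<le> 1"
    "\<And>k. k < n \<Longrightarrow> x k = (\<Sum>i<N. \<Sum>j<M. (c\<^sub>1 i * c\<^sub>2 i j * c\<^sub>3 j k) *\<^sub>C (d\<^sub>1 i * d\<^sub>2 j))"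
    "(\<Sum>i<N. (cmod (c\<^sub>1 i))\<^sup>2) \<le> t"
    "\<And>v. (\<Sum>i<N. (cmod (\<Sum>j<M. c\<^sub>2 i j * v j))\<^sup>2) \<le> (\<Sum>j<M. (cmod (v j))\<^sup>2)"
    "\<And>v. (\<Sum>j<M. (cmod (\<Sum>k<n. c\<^sub>3 j k * v k))\<^sup>2) \<le> t * (\<Sum>k<n. (cmod (v k))\<^sup>2)"
  using assms unfolding is_row_fact_def by blast+

text \<open>Arbitrary finite index sets are allowed, so that sets of signs and disjoint unions can
  index the inner dimensions directly.\<close>

lemma row_factI:
  fixes I :: "'i set" and J :: "'j set" and d\<^sub>1 :: "'i \<Rightarrow> 'a::unital_cstar_algebra"
  assumes fin: "finite I" "finite J"
    and d: "\<And>i. i \<in> I \<Longrightarrow> norm (d\<^sub>1 i) \<le> 1" "\<And>j. j \<in> J \<Longrightarrow> norm (d\<^sub>2 j) \<le> 1"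
    and x: "\<And>k. k < n \<Longrightarrow> x k = (\<Sum>i\<in>I. \<Sum>j\<in>J. (c\<^sub>1 i * c\<^sub>2 i j * c\<^sub>3 j k) *\<^sub>C (d\<^sub>1 i * d\<^sub>2 j))"
    and c1: "(\<Sum>i\<in>I. (cmod (c\<^sub>1 i))\<^sup>2) \<le> t"
    and c2: "\<And>v. (\<Sum>i\<in>I. (cmod (\<Sum>j\<in>J. c\<^sub>2 i j * v j))\<^sup>2) \<le> (\<Sum>j\<in>J. (cmod (v j))\<^sup>2)"
    and c3: "\<And>v. (\<Sum>j\<in>J. (cmod (\<Sum>k<n. c\<^sub>3 j k * v k))\<^sup>2) \<le> t * (\<Sum>k<n. (cmod (v k))\<^sup>2)"
  shows "row_fact n x t"
proof -
  obtain e where e: "bij_betw e {..<card I} I"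
    using ex_bij_betw_nat_finite[OF fin(1)] by (auto simp: atLeast0LessThan)
  obtain f where f: "bij_betw f {..<card J} J"
    using ex_bij_betw_nat_finite[OF fin(2)] by (auto simp: atLeast0LessThan)
  define g where "g = inv_into {..<card J} f"
  have g: "g (f m) = m" if "m < card J" for m
    using that bij_betw_inv_into_left[OF f] by (simp add: g_def)
  have si: "sum h I = (\<Sum>i<card I. h (e i))" for h :: "'i \<Rightarrow> 'z::comm_monoid_add"
    using sum.reindex_bij_betw[OF e, of h] by simp
  have sj: "sum h J = (\<Sum>j<card J. h (f j))" for h :: "'j \<Rightarrow> 'z::comm_monoid_add"
    using sum.reindex_bij_betw[OF f, of h] by simp
  show ?thesis
    unfolding row_fact_def is_row_fact_def
  proof (intro exI conjI allI impI)
    show "norm ((d\<^sub>1 \<circ> e) i) \<le> 1" if "i < card I" for i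
      using that e by (auto intro!: d simp: bij_betw_def)
    show "norm ((d\<^sub>2 \<circ> f) j) \<le> 1" if "j < card J" for j
      using that f by (auto intro!: d simp: bij_betw_def)
    show "x k = (\<Sum>i<card I. \<Sum>j<card J. ((c\<^sub>1 \<circ> e) i * (\<lambda>i j.
        c\<^sub>2 (e i) (f j)) i j * (\<lambda>j. c\<^sub>3 (f j)) j k) *\<^sub>C ((d\<^sub>1 \<circ> e) i * (d\<^sub>2 \<circ> f) j))"
      if "k < n" for k
      using x[OF that] by (simp add: si sj)
    show "(\<Sum>i<card I. (cmod ((c\<^sub>1 \<circ> e) i))\<^sup>2) \<le> t" using c1 by (simp add: si)
    show "(\<Sum>i<card I. (cmod (\<Sum>j<card J. (\<lambda>i j. c\<^sub>2 (e i) (f j)) i j * v j))\<^sup>2)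
        \<le> (\<Sum>j<card J. (cmod (v j))\<^sup>2)" for v
      using c2[of "v \<circ> g"] by (simp add: si sj g)
    show "(\<Sum>j<card J. (cmod (\<Sum>k<n. (\<lambda>j. c\<^sub>3 (f j)) j k * v k))\<^sup>2) \<le> t * (\<Sum>k<n. (cmod (v k))\<^sup>2)" for v
      using c3[of v] by (simp add: sj)
  qed
qed

lemma row_fact_mono:
  assumes "row_fact n x s" "s \<le> t" "\<And>k. k < n \<Longrightarrow> y k = x k" shows "row_fact n y t"
proof -
  obtain N M c\<^sub>1 c\<^sub>2 c\<^sub>3 d\<^sub>1 d\<^sub>2 where "is_row_fact n x s N M c\<^sub>1 c\<^sub>2 c\<^sub>3 d\<^sub>1 d\<^sub>2"
    using assms(1) unfolding row_fact_def by blast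
  note a = is_row_factD[OF this]
  show ?thesis
  proof (rule row_factI[where I = "{..<N}" and J = "{..<M}" and d\<^sub>1 = d\<^sub>1 and d\<^sub>2 = d\<^sub>2 and c\<^sub>1
      = c\<^sub>1 and c\<^sub>2 = c\<^sub>2 and c\<^sub>3 = c\<^sub>3])
    show "(\<Sum>i<N. (cmod (c\<^sub>1 i))\<^sup>2) \<le> t" using a(4) assms(2) by simp
    show "(\<Sum>j<M. (cmod (\<Sum>k<n. c\<^sub>3 j k * v k))\<^sup>2) \<le> t * (\<Sum>k<n. (cmod (v k))\<^sup>2)" for v
      by (rule order_trans[OF a(6)]) (intro mult_right_mono assms(2) sum_nonneg zero_le_power2)
  qed (use a assms in auto)
qed

text \<open>The outer factors become a block row and a block column, whose squared norm bounds add;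
  the middle factor is block diagonal and stays a contraction.\<close>

lemma row_fact_add:
  assumes "row_fact n x s" "row_fact n y t"
  shows "row_fact n (\<lambda>k. x k + y k) (s + t)"
proof -
  obtain N M c\<^sub>1 c\<^sub>2 c\<^sub>3 d\<^sub>1 d\<^sub>2 where "is_row_fact n x s N M c\<^sub>1 c\<^sub>2 c\<^sub>3 d\<^sub>1 d\<^sub>2"
    using assms(1) unfolding row_fact_def by blast
  note a = is_row_factD[OF this]
  obtain N' M' c\<^sub>1' c\<^sub>2' c\<^sub>3' d\<^sub>1' d\<^sub>2' where "is_row_fact n y t N' M' c\<^sub>1' c\<^sub>2' c\<^sub>3' d\<^sub>1' d\<^sub>2'"
    using assms(2) unfolding row_fact_def by blast
  note b = is_row_factD[OF this]
  define I where "I = {..<N} <+> {..<N'}"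
  define J where "J = {..<M} <+> {..<M'}"
  have sI: "sum h I = (\<Sum>i<N. h (Inl i)) + (\<Sum>i<N'. h (Inr i))" for h :: "_ \<Rightarrow> 'z::comm_monoid_add"
    by (simp add: I_def sum.Plus)
  have sJ: "sum h J = (\<Sum>i<M. h (Inl i)) + (\<Sum>i<M'. h (Inr i))" for h :: "_ \<Rightarrow> 'z::comm_monoid_add"
    by (simp add: J_def sum.Plus)
  show ?thesis
  proof (rule row_factI[where I = I and J = J and d\<^sub>1 = "case_sum d\<^sub>1 d\<^sub>1'" and d\<^sub>2 = "case_sum d\<^sub>2 d\<^sub>2'"
     and c\<^sub>1 = "case_sum c\<^sub>1 c\<^sub>1'"
     and c\<^sub>2 = "case_sum (\<lambda>i. case_sum (c\<^sub>2 i) (\<lambda>_. 0)) (\<lambda>i. case_sum (\<lambda>_. 0) (c\<^sub>2' i))"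
     and c\<^sub>3 = "case_sum c\<^sub>3 c\<^sub>3'"])
    show "finite I" "finite J" by (auto simp: I_def J_def)
    show "norm (case_sum d\<^sub>1 d\<^sub>1' i) \<le> 1" if "i \<in> I" for i using that a b by (auto simp: I_def)
    show "norm (case_sum d\<^sub>2 d\<^sub>2' j) \<le> 1" if "j \<in> J" for j using that a b by (auto simp: J_def)
    show "x k + y k = (\<Sum>i\<in>I. \<Sum>j\<in>J. (case_sum c\<^sub>1 c\<^sub>1' i * case_sum (\<lambda>i.
        case_sum (c\<^sub>2 i) (\<lambda>_. 0)) (\<lambda>i. case_sum (\<lambda>_. 0) (c\<^sub>2' i)) i j *
       case_sum c\<^sub>3 c\<^sub>3' j k) *\<^sub>C (case_sum d\<^sub>1 d\<^sub>1' i * case_sum d\<^sub>2 d\<^sub>2' j))" if "k < n" for k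
      using a(3)[OF that] b(3)[OF that] by (simp add: sI sJ)
    show "(\<Sum>i\<in>I. (cmod (case_sum c\<^sub>1 c\<^sub>1' i))\<^sup>2) \<le> s + t" using a(4) b(4) by (simp add: sI)
    show "(\<Sum>i\<in>I. (cmod (\<Sum>j\<in>J. case_sum (\<lambda>i. case_sum (c\<^sub>2 i) (\<lambda>_. 0)) (\<lambda>i. case_sum (\<lambda>_. 0) (c\<^sub>2'
        i)) i j * v j))\<^sup>2)
      \<le> (\<Sum>j\<in>J. (cmod (v j))\<^sup>2)" for v
      using add_mono[OF a(5)[of "v \<circ> Inl"] b(5)[of "v \<circ> Inr"]] by (simp add: sI sJ)
    show "(\<Sum>j\<in>J. (cmod (\<Sum>k<n. case_sum c\<^sub>3 c\<^sub>3' j k * v k))\<^sup>2) \<le> (s + t) * (\<Sum>k<n. (cmod (v k))\<^sup>2)" for v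
      using add_mono[OF a(6)[of v] b(6)[of v]] by (simp add: sJ distrib_right)
  qed
qed

text \<open>The trivial factorisation, which finishes the iteration. Each weight
  \<open>norm (x i)\<close> is split into two square roots, one for each outer factor. For
  \<open>x i = 0\<close> division by zero yields 0, which still lies in the unit ball.\<close>

lemma row_fact_sum_norm:
  fixes x :: "nat \<Rightarrow> 'a::unital_cstar_algebra"
  shows "row_fact n x (\<Sum>k<n. norm (x k))"
proof (rule row_factI[where I = "{..<n}" and J = "{..<n}" and d\<^sub>1 = "\<lambda>i. (1 / norm (x i)) *\<^sub>R x i"
    and d\<^sub>2 = "\<lambda>_. 1"
     and c\<^sub>1 = "\<lambda>i. of_real (sqrt (norm (x i)))" and c\<^sub>2 = "\<lambda>i j. if j = i then 1 else 0"
     and c\<^sub>3 = "\<lambda>j k. if k = j then of_real (sqrt (norm (x j))) else 0"])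
  show "x k = (\<Sum>i<n. \<Sum>j<n. (complex_of_real (sqrt (norm (x i))) * (if j = i then 1 else 0) *
       (if k = j then complex_of_real (sqrt (norm (x j))) else 0)) *\<^sub>C ((1 / norm (x i)) *\<^sub>R
           x i * 1))" if k: "k < n" for k
  proof -
    have "(\<Sum>i<n. \<Sum>j<n. (complex_of_real (sqrt (norm (x i))) * (if j = i then 1 else 0) *
       (if k = j then complex_of_real (sqrt (norm (x j))) else 0)) *\<^sub>C ((1 / norm (x i)) *\<^sub>R x i * 1))
      = (\<Sum>i<n. \<Sum>j<n. if j = i then (if i = k then x i else 0) else 0)"
      by (intro sum.cong refl)
        (auto simp: scaleR_eq_scaleC scaleC_scaleC simp flip: of_real_mult)
    then show ?thesis using k by simp
  qed
  show "(\<Sum>j<n. (cmod (\<Sum>k<n. (if k = j then complex_of_real (sqrt (norm (x j))) else 0) * v k))\<^sup>2)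
         \<le> (\<Sum>k<n. norm (x k)) * (\<Sum>k<n. (cmod (v k))\<^sup>2)" for v
  proof -
    have "(\<Sum>j<n. (cmod (\<Sum>k<n. (if k = j then complex_of_real (sqrt (norm (x j))) else 0) * v k))\<^sup>2)
       = (\<Sum>j<n. norm (x j) * (cmod (v j))\<^sup>2)"
      by (intro sum.cong refl) (simp add: if_distrib[of
          "\<lambda>c. c * _"] norm_mult power_mult_distrib cong: if_cong)
    also have "\<dots> \<le> (\<Sum>j<n. (\<Sum>k<n. norm (x k)) * (cmod (v j))\<^sup>2)"
      by (intro sum_mono mult_right_mono member_le_sum) auto
    finally show ?thesis by (simp add: sum_distrib_left)
  qed
  show "(\<Sum>i<n. (cmod (\<Sum>j<n. (if j = i then 1 else 0) * v j))\<^sup>2) \<le> (\<Sum>j<n. (cmod (v j))\<^sup>2)" for v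
    by (simp add: if_distrib[of "\<lambda>c. c * _"] cong: if_cong)
qed auto

text \<open>Parseval: the matrix of signs divided by \<open>sqrt (2 ^ n)\<close> is an isometry,
  hence admissible as the middle factor.\<close>

lemma sum_norm_rademacher_square:
  fixes v :: "nat \<Rightarrow> complex"
  shows "(\<Sum>A\<in>Pow {..<n}. (cmod (rademacher_sum n v A))\<^sup>2) = 2 ^ n * (\<Sum>k<n. (cmod (v k))\<^sup>2)"
proof -
  have "cnj (rademacher_sum n v A) = rademacher_sum n (\<lambda>k. cnj (v k)) A" for A
    by (simp add: rademacher_sum_def)
  then have "complex_of_real (\<Sum>A\<in>Pow {..<n}. (cmod (rademacher_sum n v A))\<^sup>2)
     = (\<Sum>A\<in>Pow {..<n}. rademacher_sum n v A * rademacher_sum n (\<lambda>k. cnj (v k)) A)"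
    by (simp add: complex_norm_square del: of_real_power)
  also have "\<dots> = complex_of_real (2 ^ n * (\<Sum>k<n. (cmod (v k))\<^sup>2))"
    unfolding sum_rademacher_square
    by (simp add: complex_norm_square scaleR_conv_of_real del: of_real_power)
  finally show ?thesis by (simp only: of_real_eq_iff)
qed

lemma row_fact_rademacher:
  fixes T :: "nat set \<Rightarrow> 'a::unital_cstar_algebra"
  assumes t: "t > 0" and T: "\<And>A. norm (T A) \<le> t" and w: "\<And>k. norm (w k) \<le> 1"
  shows "row_fact n (\<lambda>k. (1 / 2 ^ n) *\<^sub>R (\<Sum>A\<in>Pow {..<n}. eps A k *\<^sub>R T A) * w k) t"
proof -
  \<comment> \<open>The averaging factor \<open>1 / 2 ^ n\<close> is shared equally: one
    \<open>1 / s\<close> makes the sign matrix isometric, the other offsets the \<open>2 ^ n\<close>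
    entries of the first row.\<close>
  define s :: real where "s = sqrt (2 ^ n)"
  have s: "s > 0" "s * s = 2 ^ n" by (auto simp: s_def)
  show ?thesis
  proof (rule row_factI[where I = "Pow {..<n}" and J = "{..<n}" and d\<^sub>1 = "\<lambda>A. (1 / t) *\<^sub>R T A"
      and d\<^sub>2 = w
     and c\<^sub>1 = "\<lambda>A. of_real (sqrt t / s)" and c\<^sub>2 = "\<lambda>A j. of_real (eps A j / s)"
     and c\<^sub>3 = "\<lambda>j k. if j = k then of_real (sqrt t) else 0"])
    show "norm ((1 / t) *\<^sub>R T A) \<le> 1" for A using T[of A] t by simp
    show "(1 / 2 ^ n) *\<^sub>R (\<Sum>A\<in>Pow {..<n}. eps A k *\<^sub>R T A) * w k =
       (\<Sum>A\<in>Pow {..<n}. \<Sum>j<n. (of_real (sqrt t / s) * of_real (eps A j / s) * (if j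
           = k then of_real (sqrt t) else 0)) *\<^sub>C ((1 / t) *\<^sub>R T A * w j))"
      if "k < n" for k
    proof -
      have c: "sqrt t / s * (eps A k / s) * sqrt t * (1 / t) = 1 / 2 ^ n * eps A k" for A
        using t s by (simp add: field_simps)
      have "(\<Sum>A\<in>Pow {..<n}. \<Sum>j<n. (complex_of_real (sqrt t / s) * of_real (eps A j / s) * (if j
          = k then of_real (sqrt t) else 0)) *\<^sub>C ((1 / t) *\<^sub>R T A * w j))
        = (\<Sum>A\<in>Pow {..<n}. \<Sum>j<n. if j = k then (1 / 2 ^ n * eps A k) *\<^sub>R (T A * w k) else 0)"
        unfolding c[symmetric]
        by (intro sum.cong refl) (simp add: scaleR_eq_scaleC scaleC_scaleC mult_scaleC_left)
      also have "\<dots> = (\<Sum>A\<in>Pow {..<n}. (1 / 2 ^ n * eps A k) *\<^sub>R (T A * w k))" using that by simp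
      also have "\<dots> = (1 / 2 ^ n) *\<^sub>R (\<Sum>A\<in>Pow {..<n}. eps A k *\<^sub>R T A) * w k"
        by (simp add: scaleR_sum_right sum_distrib_right)
      finally show ?thesis ..
    qed
    show "(\<Sum>A\<in>Pow {..<n}. (cmod (of_real (sqrt t / s)))\<^sup>2) \<le> t"
      using t s by (simp add: card_Pow norm_divide power_divide power2_eq_square)
    show "(\<Sum>A\<in>Pow {..<n}. (cmod (\<Sum>j<n. complex_of_real (eps A j / s) * v j))\<^sup>2)
        \<le> (\<Sum>j<n. (cmod (v j))\<^sup>2)" for v
    proof -
      have "(\<Sum>j<n. complex_of_real (eps A j / s) * v j) = rademacher_sum n v A / of_real s" for A
        by (simp add: rademacher_sum_def sum_divide_distrib scaleR_conv_of_real)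
      then have "(\<Sum>A\<in>Pow {..<n}. (cmod (\<Sum>j<n. complex_of_real (eps A j / s) * v j))\<^sup>2)
         = (\<Sum>A\<in>Pow {..<n}. (cmod (rademacher_sum n v A))\<^sup>2 / 2 ^ n)"
        using s by (simp add: norm_divide power_divide power2_eq_square)
      then show ?thesis unfolding sum_divide_distrib[symmetric] sum_norm_rademacher_square by simp
    qed
    show "(\<Sum>j<n. (cmod (\<Sum>k<n. (if j = k then complex_of_real (sqrt t) else 0) * v k))\<^sup>2)
        \<le> t * (\<Sum>k<n. (cmod (v k))\<^sup>2)" for v
      using t by (simp add: if_distrib[of "\<lambda>c. c * _"] norm_mult power_mult_distrib sum_distrib_left
          cong: if_cong)
  qed (use w in auto)
qed

lemma norm_sq_entry_le_row:
  fixes x :: "nat \<Rightarrow> 'a::unital_cstar_algebra"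
  assumes "k < n" shows "(norm (x k))\<^sup>2 \<le> norm (\<Sum>k<n. x k * star (x k))"
proof -
  have "(\<Sum>k<n. x k * star (x k)) - x k * star (x k) = (\<Sum>j\<in>{..<n} - {k}. x j * star (x j))"
    using assms by (simp add: sum_diff1)
  then have "pos ((\<Sum>k<n. x k * star (x k)) - x k * star (x k))" by (simp add: pos_sum pos_mult_star_self)
  from norm_mono_pos[OF pos_mult_star_self this] show ?thesis by (simp add: norm_self_mult_star)
qed

section \<open>Iteration of the approximation step\<close>

text \<open>The first summand is the partial geometric sum of sqrt 3 / 2^i over i < m. The second is
  the trivial factorisation of the last remainder, of norm at most \<open>sqrt q / 2 ^ m\<close>,
  each of whose \<open>n\<close> entries is bounded by that norm.\<close>

lemma row_fact_iterate:
  fixes x :: "nat \<Rightarrow> 'a::unital_cstar_algebra"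
  assumes "q > 0" "norm (\<Sum>k<n. x k * star (x k)) \<le> q"
  shows "row_fact n x ((2 * sqrt 3 * (1 - 1 / 2 ^ m) + n / 2 ^ m) * sqrt q)"
  using assms
proof (induction m arbitrary: x q)
  case 0
  have "norm (x k) \<le> sqrt q" if "k < n" for k
    using norm_sq_entry_le_row[OF that, of x] 0 by (intro real_le_rsqrt) auto
  then have "(\<Sum>k<n. norm (x k)) \<le> n * sqrt q"
    using sum_bounded_above[of "{..<n}" "\<lambda>k. norm (x k)" "sqrt q"] by simp
  then show ?case by (intro row_fact_mono[OF row_fact_sum_norm]) auto
next
  case (Suc m)
  obtain T w z where s: "\<And>A. norm (T A) \<le> sqrt (3 * q)" "\<And>k. norm (w k) \<le> 1"
    "\<And>k. k < n \<Longrightarrow> x k = (1 / 2 ^ n) *\<^sub>R (\<Sum>A\<in>Pow {..<n}. eps A k *\<^sub>R T A) * w k + z k"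
    "norm (\<Sum>k<n. z k * star (z k)) \<le> q / 4"
    by (rule approximation_step[OF Suc.prems]) (rule that, assumption+)
  have z: "row_fact n z ((2 * sqrt 3 * (1 - 1 / 2 ^ m) + n / 2 ^ m) * sqrt (q / 4))"
    using Suc.prems s(4) by (intro Suc.IH) auto
  have y: "row_fact n (\<lambda>k. (1 / 2 ^ n) *\<^sub>R (\<Sum>A\<in>Pow {..<n}. eps A k *\<^sub>R T A) * w k) (sqrt (3 * q))"
    using Suc.prems s by (intro row_fact_rademacher) auto
  have "sqrt (3 * q) + (2 * sqrt 3 * (1 - 1 / 2 ^ m) + n / 2 ^ m) * sqrt (q / 4)
     = (2 * sqrt 3 * (1 - 1 / 2 ^ Suc m) + n / 2 ^ Suc m) * sqrt q"
    by (simp add: real_sqrt_mult real_sqrt_divide field_simps)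
  then show ?case using row_fact_add[OF y z] s(3) by (intro row_fact_mono[OF row_fact_add[OF y z]]) auto
qed

text \<open>With as many rounds as entries the remainder term is \<open>n / 2 ^ n \<le> 1\<close>,
  and 2 sqrt 3 \<le> 4 gives the constant 5. The zero row is separate because the approximation step
  needs \<open>q > 0\<close>.\<close>

theorem row_fact_bound:
  fixes x :: "nat \<Rightarrow> 'a::unital_cstar_algebra"
  shows "row_fact n x (5 * sqrt (norm (\<Sum>k<n. x k * star (x k))))"
proof (cases "norm (\<Sum>k<n. x k * star (x k)) = 0")
  case True
  then have "norm (x k) = 0" if "k < n" for k using norm_sq_entry_le_row[OF that, of x] by simp
  then show ?thesis using True row_fact_sum_norm[of n x] by simp
next
  case False
  define q where "q = norm (\<Sum>k<n. x k * star (x k))"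
  have q: "q > 0" using False by (simp add: q_def)
  have "row_fact n x ((2 * sqrt 3 * (1 - 1 / 2 ^ n) + n / 2 ^ n) * sqrt q)"
    by (rule row_fact_iterate[OF q]) (simp add: q_def)
  moreover have "(2 * sqrt 3 * (1 - 1 / 2 ^ n) + n / 2 ^ n) \<le> 5"
  proof -
    have "real n / 2 ^ n \<le> 1" using of_nat_mono[OF less_imp_le[OF less_exp[of n]], where 'a = real]
        by simp
    moreover have "2 * sqrt 3 * (1 - 1 / 2 ^ n) \<le> 2 * sqrt 3 * 1" by (intro mult_left_mono) auto
    moreover have "sqrt 3 \<le> 2" by (rule real_le_lsqrt) auto
    ultimately show ?thesis by linarith
  qed
  ultimately show ?thesis unfolding q_def[symmetric] using q
      by (elim row_fact_mono) (auto intro: mult_right_mono)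
qed

section \<open>Matrix norms\<close>

lemma col_norm_complex: "col_norm (a :: complex vec) = sqrt (\<Sum>i<dim_vec a. (cmod (a $ i))\<^sup>2)"
proof -
  have "(\<Sum>i<dim_vec a. star (a $ i) * a $ i) = of_real (\<Sum>i<dim_vec a. (cmod (a $ i))\<^sup>2)"
    by (simp add: star_complex_def complex_norm_square mult.commute del: of_real_power)
  then show ?thesis unfolding col_norm_def by (simp only: norm_of_real) (simp add: sum_nonneg)
qed

lemma mult_mat_vec_index:
  "i < dim_row X \<Longrightarrow> dim_vec a = dim_col X \<Longrightarrow> (X *\<^sub>v a) $ i = (\<Sum>j<dim_col X. X $$ (i, j) * a $ j)"
  by (simp add: scalar_prod_def atLeast0LessThan)

lemma norm_entry_le_col_norm:
  assumes "j < dim_vec a" shows "norm (a $ j) \<le> col_norm a"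
proof -
  have "(norm (a $ j))\<^sup>2 \<le> norm (\<Sum>i<dim_vec a. star (a $ i) * a $ i)"
    using norm_sq_entry_le_row[OF assms, of "\<lambda>i. star (a $ i)"] by (simp add: norm_star star_star)
  then show ?thesis unfolding col_norm_def by (rule real_le_rsqrt)
qed

lemma col_norm_le: "col_norm a \<le> sqrt (\<Sum>i<dim_vec a. (norm (a $ i))\<^sup>2)"
  unfolding col_norm_def norm_star_mult_self[symmetric] by (intro real_sqrt_le_mono norm_sum)

text \<open>Entries of a vector in the unit ball have norm at most 1, so sums of entry norms give a
  crude bound; it makes the supremum in \<open>mat_norm\<close> usable.\<close>

lemma bdd_above_mat_norm:
  fixes X :: "'a::unital_cstar_algebra mat"
  shows "bdd_above ((\<lambda>a. col_norm (X *\<^sub>v a)) ` {a \<in> carrier_vec (dim_col X). col_norm a \<le> 1})"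
proof (rule bdd_aboveI2)
  fix a :: "'a vec" assume "a \<in> {a \<in> carrier_vec (dim_col X). col_norm a \<le> 1}"
  then have a: "dim_vec a = dim_col X" "col_norm a \<le> 1" by auto
  have "norm ((X *\<^sub>v a) $ i) \<le> (\<Sum>j<dim_col X. norm (X $$ (i, j)))" if "i < dim_row X" for i
  proof -
    have "norm ((X *\<^sub>v a) $ i) \<le> (\<Sum>j<dim_col X. norm (X $$ (i, j) * a $ j))"
      unfolding mult_mat_vec_index[OF that a(1)] by (rule norm_sum)
    also have "\<dots> \<le> (\<Sum>j<dim_col X. norm (X $$ (i, j)))"
    proof (rule sum_mono)
      fix j assume "j \<in> {..<dim_col X}"
      then have "norm (a $ j) \<le> 1" using norm_entry_le_col_norm[of j a] a by simp
      then have "norm (X $$ (i, j)) * norm (a $ j) \<le> norm (X $$ (i, j))" by (simp add: mult_left_le)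
      then show "norm (X $$ (i, j) * a $ j) \<le> norm (X $$ (i, j))"
        using norm_mult_ineq order_trans by blast
    qed
    finally show ?thesis .
  qed
  then have "(\<Sum>i<dim_row X. (norm ((X *\<^sub>v a) $ i))\<^sup>2) \<le> (\<Sum>i<dim_row X. (\<Sum>j<dim_col X. norm (X $$ (i,
      j)))\<^sup>2)"
    by (intro sum_mono power_mono) auto
  then show "col_norm (X *\<^sub>v a) \<le> sqrt (\<Sum>i<dim_row X. (\<Sum>j<dim_col X. norm (X $$ (i, j)))\<^sup>2)"
    by (intro order_trans[OF col_norm_le] real_sqrt_le_mono) simp
qed

lemma col_norm_mult_le_mat_norm:
  assumes "a \<in> carrier_vec (dim_col X)" "col_norm a \<le> 1"
  shows "col_norm (X *\<^sub>v a) \<le> mat_norm X"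
  unfolding mat_norm_def using assms by (intro cSUP_upper bdd_above_mat_norm) simp

lemma mat_norm_nonneg: "mat_norm (X :: 'a::unital_cstar_algebra mat) \<ge> 0"
proof -
  have "col_norm (0\<^sub>v (dim_col X) :: 'a vec) \<le> 1" by (simp add: col_norm_def)
  then have "col_norm (X *\<^sub>v 0\<^sub>v (dim_col X)) \<le> mat_norm X" by (intro col_norm_mult_le_mat_norm) auto
  moreover have "0 \<le> col_norm (X *\<^sub>v 0\<^sub>v (dim_col X))" by (simp add: col_norm_def)
  ultimately show ?thesis by linarith
qed

lemma mat_norm_complex_le:
  fixes C :: "complex mat"
  assumes \<beta>: "\<beta> \<ge> 0"
    and C: "\<And>v. (\<Sum>i<dim_row C. (cmod (\<Sum>j<dim_col C. C $$ (i, j) * v j))\<^sup>2)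
        \<le> \<beta> * (\<Sum>j<dim_col C. (cmod (v j))\<^sup>2)"
  shows "mat_norm C \<le> sqrt \<beta>"
  unfolding mat_norm_def
proof (rule cSUP_least)
  have "0\<^sub>v (dim_col C) \<in> {a \<in> carrier_vec (dim_col C). col_norm (a :: complex vec) \<le> 1}"
    by (simp add: col_norm_def)
  then show "{a \<in> carrier_vec (dim_col C). col_norm (a :: complex vec) \<le> 1} \<noteq> {}" by blast
  fix a :: "complex vec" assume "a \<in> {a \<in> carrier_vec (dim_col C). col_norm a \<le> 1}"
  then have a: "dim_vec a = dim_col C" "(\<Sum>j<dim_col C. (cmod (a $ j))\<^sup>2) \<le> 1"
    by (auto simp: col_norm_complex)
  have "(\<Sum>i<dim_row C. (cmod ((C *\<^sub>v a) $ i))\<^sup>2) = (\<Sum>i<dim_row C. (cmod (\<Sum>j<dim_col C. C $$ (i, j) *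
      a $ j))\<^sup>2)"
    using a(1) by (intro sum.cong refl) (simp add: mult_mat_vec_index del: index_mult_mat_vec)
  also have "\<dots> \<le> \<beta> * (\<Sum>j<dim_col C. (cmod (a $ j))\<^sup>2)" by (rule C)
  also have "\<dots> \<le> \<beta>" using a(2) \<beta> by (simp add: mult_left_le)
  finally show "col_norm (C *\<^sub>v a) \<le> sqrt \<beta>" by (simp add: col_norm_complex)
qed

text \<open>The row is tested on its own normalised adjoint column, as in the equality case of
  Cauchy-Schwarz.\<close>

lemma norm_row_le_mat_norm:
  fixes X :: "'a::unital_cstar_algebra mat"
  assumes X: "X \<in> carrier_mat 1 n"
  shows "sqrt (norm (\<Sum>k<n. X $$ (0, k) * star (X $$ (0, k)))) \<le> mat_norm X"
proof (cases "(\<Sum>k<n. X $$ (0, k) * star (X $$ (0, k))) = 0")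
  case True
  then show ?thesis using mat_norm_nonneg[of X] by simp
next
  case False
  define h where "h = (\<Sum>k<n. X $$ (0, k) * star (X $$ (0, k)))"
  define s where "s = sqrt (norm h)"
  have s: "s > 0" "norm h = s * s" using False by (simp_all add: s_def h_def)
  define a where "a = vec n (\<lambda>k. (1 / s) *\<^sub>R star (X $$ (0, k)))"
  have "(\<Sum>i<dim_vec a. star (a $ i) * a $ i) = (1 / (s * s)) *\<^sub>R h"
    by (simp add: a_def h_def star_simps scaleR_sum_right)
  then have "col_norm a = 1" using s by (simp add: col_norm_def)
  moreover have "a \<in> carrier_vec (dim_col X)" using X by (simp add: a_def)
  ultimately have le: "col_norm (X *\<^sub>v a) \<le> mat_norm X" by (intro col_norm_mult_le_mat_norm) auto
  have dr: "dim_row X = 1" "dim_col X = n" using X by auto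
  have "(X *\<^sub>v a) $ 0 = (\<Sum>k<n. X $$ (0, k) * a $ k)"
    using mult_mat_vec_index[of 0 X a] dr by (simp add: a_def)
  also have "\<dots> = (1 / s) *\<^sub>R h" by (simp add: a_def h_def scaleR_sum_right)
  finally have Xa: "(X *\<^sub>v a) $ 0 = (1 / s) *\<^sub>R h" .
  have "dim_vec (X *\<^sub>v a) = 1" by (simp add: dr)
  then have "col_norm (X *\<^sub>v a) = sqrt (norm (star ((X *\<^sub>v a) $ 0) * (X *\<^sub>v a) $ 0))"
    unfolding col_norm_def by (simp add: lessThan_Suc del: index_mult_mat_vec dim_mult_mat_vec)
  also have "\<dots> = norm ((1 / s) *\<^sub>R h)" unfolding norm_star_mult_self Xa by simp
  finally have "col_norm (X *\<^sub>v a) = norm ((1 / s) *\<^sub>R h)" .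
  also have "\<dots> = s" using s by simp
  finally show ?thesis using le by (simp add: s_def h_def)
qed

lemma mat_norm_pos:
  fixes X :: "'a::unital_cstar_algebra mat"
  assumes X: "X \<in> carrier_mat 1 n" "X \<noteq> 0\<^sub>m 1 n"
  shows "mat_norm X > 0"
proof -
  obtain k where k: "k < n" "X $$ (0, k) \<noteq> 0" using X by (auto simp: mat_eq_iff)
  have "0 < (norm (X $$ (0, k)))\<^sup>2" using k by simp
  also have "\<dots> \<le> norm (\<Sum>k<n. X $$ (0, k) * star (X $$ (0, k)))"
    using norm_sq_entry_le_row[OF k(1), of "\<lambda>k. X $$ (0, k)"] .
  finally show ?thesis using norm_row_le_mat_norm[OF X(1)] real_sqrt_gt_zero less_le_trans by blast
qed

section \<open>From indexed sums to matrix factorisations\<close>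

lemma index_mult_diagonal:
  fixes A D :: "'a::semiring_0 mat"
  assumes "A \<in> carrier_mat m N" "D \<in> carrier_mat N N" "diagonal_mat D" "i < m" "j < N"
  shows "(A * D) $$ (i, j) = A $$ (i, j) * D $$ (j, j)"
proof -
  have "(A * D) $$ (i, j) = (\<Sum>l<N. A $$ (i, l) * D $$ (l, j))"
    using assms by (simp add: scalar_prod_def atLeast0LessThan)
  also have "\<dots> = (\<Sum>l<N. if l = j then A $$ (i, j) * D $$ (j, j) else 0)"
    using assms by (intro sum.cong) (auto simp: diagonal_mat_def)
  finally show ?thesis using assms by simp
qed

lemma index_mult_scalar_mat:
  fixes A :: "'a::unital_cstar_algebra mat"
  assumes "A \<in> carrier_mat m N" "C \<in> carrier_mat N p" "i < m" "j < p"
  shows "(A * scalar_mat C) $$ (i, j) = (\<Sum>l<N. C $$ (l, j) *\<^sub>C A $$ (i, l))"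
  using assms by (simp add: scalar_prod_def atLeast0LessThan scalar_mat_def mult_scaleC_right)

lemma index_alt_prod_2:
  fixes D :: "nat \<Rightarrow> 'a::unital_cstar_algebra mat"
  assumes C: "C 1 \<in> carrier_mat 1 N" "C 2 \<in> carrier_mat N N" "C 3 \<in> carrier_mat N n"
    and D: "D 1 \<in> carrier_mat N N" "D 2 \<in> carrier_mat N N" "diagonal_mat (D 1)" "diagonal_mat (D 2)"
    and k: "k < n"
  shows "alt_prod C D 2 $$ (0, k) = (\<Sum>i<N. \<Sum>j<N.
     (C 1 $$ (0, i) * C 2 $$ (i, j) * C 3 $$ (j, k)) *\<^sub>C (D 1 $$ (i, i) * D 2 $$ (j, j)))"
proof -
  have z: "(0::nat) < 1" by simp
  have sC: "scalar_mat (C 1) \<in> carrier_mat 1 N" "scalar_mat (C 2) \<in> carrier_mat N N"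
    using C by (auto simp: scalar_mat_def)
  define A where "A = scalar_mat (C 1) * D 1"
  define B where "B = A * scalar_mat (C 2)"
  have A: "A \<in> carrier_mat 1 N" unfolding A_def by (rule mult_carrier_mat[OF sC(1) D(1)])
  have B: "B \<in> carrier_mat 1 N" unfolding B_def by (rule mult_carrier_mat[OF A sC(2)])
  have BD: "B * D 2 \<in> carrier_mat 1 N" by (rule mult_carrier_mat[OF B D(2)])
  have Ai: "A $$ (0, i) = C 1 $$ (0, i) *\<^sub>C D 1 $$ (i, i)" if "i < N" for i
    unfolding A_def index_mult_diagonal[OF sC(1) D(1) D(3) z that]
    using that C by (simp add: scalar_mat_def mult_scaleC_left)
  have Bj: "B $$ (0, j) = (\<Sum>i<N. (C 1 $$ (0, i) * C 2 $$ (i, j)) *\<^sub>C D 1 $$ (i, i))" if "j < N" for j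
    unfolding B_def index_mult_scalar_mat[OF A C(2) z that]
    by (intro sum.cong) (simp_all add: Ai scaleC_scaleC mult.commute)
  have sc: "c *\<^sub>C (\<Sum>i\<in>I. f i) = (\<Sum>i\<in>I. c *\<^sub>C f i)" for c and f :: "nat \<Rightarrow> 'a" and I
    by (induction I rule: infinite_finite_induct) (auto simp: scaleC_add_right)
  have "alt_prod C D 2 = B * D 2 * scalar_mat (C 3)"
    by (simp add: numeral_2_eq_2 numeral_3_eq_3 A_def B_def)
  then have "alt_prod C D 2 $$ (0, k) = (\<Sum>j<N. C 3 $$ (j, k) *\<^sub>C (B * D 2) $$ (0, j))"
    using index_mult_scalar_mat[OF BD C(3) z k] by simp
  also have "\<dots> = (\<Sum>j<N. \<Sum>i<N. (C 1 $$ (0, i) * C 2 $$ (i, j) * C 3 $$ (j, k)) *\<^sub>C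
      (D 1 $$ (i, i) * D 2 $$ (j, j)))"
    by (intro sum.cong refl)
      (simp add: index_mult_diagonal[OF
          B D(2) D(4) z] Bj sum_distrib_right mult_scaleC_left sc scaleC_scaleC mult_ac)
  finally show ?thesis using sum.swap by simp
qed

text \<open>Both inner dimensions are padded to their maximum. The new diagonal entries are 0, and
  zero rows and columns preserve the bounds on the scalar matrices. The norms multiply to at most
  \<open>sqrt t * 1 * sqrt t\<close>.\<close>

lemma factorisation_of_row_fact:
  fixes X :: "'a::unital_cstar_algebra mat"
  assumes X: "X \<in> carrier_mat 1 n" and f: "row_fact n (\<lambda>k. X $$ (0, k)) t"
  shows "\<exists>N C D. is_factorisation 2 X N C D \<and> (\<Prod>i=1..2 + 1. mat_norm (C i)) \<le> t"
proof -
  obtain N1 N2 c\<^sub>1 c\<^sub>2 c\<^sub>3 d\<^sub>1 d\<^sub>2 where "is_row_fact n (\<lambda>k. X $$ (0, k)) t N1 N2 c\<^sub>1 c\<^sub>2 c\<^sub>3 d\<^sub>1 d\<^sub>2"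
    using f unfolding row_fact_def by blast
  note a = is_row_factD[OF this]
  have t: "t \<ge> 0" using a(4) sum_nonneg[of "{..<N1}" "\<lambda>i. (cmod (c\<^sub>1 i))\<^sup>2"] by simp
  define N where "N = max N1 N2"
  have N: "N1 \<le> N" "N2 \<le> N" by (auto simp: N_def)
  have cut: "(\<Sum>i<N. if i < L then g i else 0) = (\<Sum>i<L. g i)" if "L \<le> N" for L and g ::
      "nat \<Rightarrow> 'z::comm_monoid_add"
  proof -
    have "(\<Sum>i<N. if i < L then g i else 0) = (\<Sum>i<L. if i < L then g i else 0)"
      using that by (intro sum.mono_neutral_right) auto
    then show ?thesis by simp
  qed
  define C1 where "C1 = mat 1 N (\<lambda>(_, i). if i < N1 then c\<^sub>1 i else 0)"
  define C2 where "C2 = mat N N (\<lambda>(i, j). if i < N1 then if j < N2 then c\<^sub>2 i j else 0 else 0)"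
  define C3 where "C3 = mat N n (\<lambda>(j, k). if j < N2 then c\<^sub>3 j k else 0)"
  define D1 where "D1 = mat N N (\<lambda>(i, j). if i = j \<and> i < N1 then d\<^sub>1 i else 0)"
  define D2 where "D2 = mat N N (\<lambda>(i, j). if i = j \<and> i < N2 then d\<^sub>2 i else 0)"
  define C where "C i = (if i = 1 then C1 else if i = 2 then C2 else C3)" for i :: nat
  define D where "D i = (if i = 1 then D1 else D2)" for i :: nat
  have car: "C 1 \<in> carrier_mat 1 N" "C 2 \<in> carrier_mat N N" "C 3 \<in> carrier_mat N n"
      "D 1 \<in> carrier_mat N N" "D 2 \<in> carrier_mat N N"
    by (auto simp: C_def D_def C1_def C2_def C3_def D1_def D2_def)
  have diag: "diagonal_mat (D 1)" "diagonal_mat (D 2)"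
    by (auto simp: D_def D1_def D2_def diagonal_mat_def)
  have "X $$ (0, k) = alt_prod C D 2 $$ (0, k)" if k: "k < n" for k
  proof -
    have "alt_prod C D 2 $$ (0, k) = (\<Sum>i<N. \<Sum>j<N. if i < N1 then if j < N2 then
        (c\<^sub>1 i * c\<^sub>2 i j * c\<^sub>3 j k) *\<^sub>C (d\<^sub>1 i * d\<^sub>2 j) else 0 else 0)"
      unfolding index_alt_prod_2[OF car diag k]
      using k by (intro sum.cong refl) (auto simp: C_def D_def C1_def C2_def C3_def D1_def D2_def)
    also have "\<dots> = (\<Sum>i<N. if i < N1 then (\<Sum>j<N. if j < N2 then (c\<^sub>1 i * c\<^sub>2 i j * c\<^sub>3 j k)
        *\<^sub>C (d\<^sub>1 i * d\<^sub>2 j) else 0) else 0)"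
      by (intro sum.cong refl) auto
    finally show ?thesis using a(3)[OF k] by (simp only: cut N)
  qed
  moreover have "dim_row (alt_prod C D 2) = 1" "dim_col (alt_prod C D 2) = n"
    using car by (auto simp: numeral_2_eq_2 numeral_3_eq_3 scalar_mat_def)
  ultimately have XA: "X = alt_prod C D 2" using X by (intro eq_matI) auto
  have "is_factorisation 2 X N C D"
    unfolding is_factorisation_def
  proof (intro conjI ballI allI impI)
    show "C (2 + 1) \<in> carrier_mat N (dim_col X)" using car X by simp
    fix k :: nat
    { assume "k \<in> {2..2}" then show "C k \<in> carrier_mat N N" using car by simp }
    assume "k \<in> {1..2}"
    then have k: "k = 1 \<or> k = 2" by auto
    then show "D k \<in> carrier_mat N N" "diagonal_mat (D k)" using car diag by auto
    show "norm (D k $$ (i, i)) \<le> 1" if "i < N" for i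
      using k that a(1,2) by (auto simp: D_def D1_def D2_def)
  qed (use car XA in auto)
  moreover have "(\<Prod>i=1..2 + 1. mat_norm (C i)) \<le> t"
  proof -
    have m1: "mat_norm C1 \<le> sqrt t"
    proof (rule mat_norm_complex_le[OF t])
      fix v
      have "cmod (\<Sum>j<N1. c\<^sub>1 j * v j) \<le> (\<Sum>j<N1. cmod (c\<^sub>1 j) * cmod (v j))"
        by (rule order_trans[OF norm_sum]) (simp add: norm_mult)
      then have "(cmod (\<Sum>j<N1. c\<^sub>1 j * v j))\<^sup>2 \<le> (\<Sum>j<N1. cmod (c\<^sub>1 j) * cmod (v j))\<^sup>2"
        by (rule power_mono) simp
      also have "\<dots> \<le> (\<Sum>j<N1. (cmod (c\<^sub>1 j))\<^sup>2) * (\<Sum>j<N1. (cmod (v j))\<^sup>2)"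
        by (rule Cauchy_Schwarz_ineq_sum)
      also have "\<dots> \<le> t * (\<Sum>j<N. (cmod (v j))\<^sup>2)"
        using N t a(4) by (intro mult_mono sum_mono2 sum_nonneg) auto
      finally have *: "(cmod (\<Sum>j<N1. c\<^sub>1 j * v j))\<^sup>2 \<le> t * (\<Sum>j<N. (cmod (v j))\<^sup>2)" .
      have "(\<Sum>j<N. C1 $$ (0, j) * v j) = (\<Sum>j<N. if j < N1 then c\<^sub>1 j * v j else 0)"
        by (intro sum.cong) (auto simp: C1_def)
      then show "(\<Sum>i<dim_row C1. (cmod (\<Sum>j<dim_col C1. C1 $$ (i, j) * v j))\<^sup>2)
          \<le> t * (\<Sum>j<dim_col C1. (cmod (v j))\<^sup>2)"
        using * by (simp add: C1_def[THEN arg_cong[of _ _ dim_row]] C1_def[THEN arg_cong[of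
            _ _ dim_col]] lessThan_Suc cut N)
    qed
    have m2: "mat_norm C2 \<le> sqrt 1"
    proof (rule mat_norm_complex_le)
      fix v
      have "(\<Sum>i<N. (cmod (\<Sum>j<N. C2 $$ (i, j) * v j))\<^sup>2)
        = (\<Sum>i<N. if i < N1 then (cmod (\<Sum>j<N. if j < N2 then c\<^sub>2 i j * v j else 0))\<^sup>2 else 0)"
        by (intro sum.cong refl) (auto simp: C2_def if_distrib[of "\<lambda>c. c * _"] cong: if_cong)
      also have "\<dots> \<le> (\<Sum>j<N2. (cmod (v j))\<^sup>2)" unfolding cut[OF N(1)] cut[OF N(2)] by (rule a(5))
      also have "\<dots> \<le> (\<Sum>j<N. (cmod (v j))\<^sup>2)" using N by (intro sum_mono2) auto
      finally show "(\<Sum>i<dim_row C2. (cmod (\<Sum>j<dim_col C2. C2 $$ (i, j) * v j))\<^sup>2)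
          \<le> 1 * (\<Sum>j<dim_col C2. (cmod (v j))\<^sup>2)"
        by (simp add: C2_def)
    qed simp
    have m3: "mat_norm C3 \<le> sqrt t"
    proof (rule mat_norm_complex_le[OF t])
      fix v
      have "(\<Sum>j<N. (cmod (\<Sum>k<n. C3 $$ (j, k) * v k))\<^sup>2)
        = (\<Sum>j<N. if j < N2 then (cmod (\<Sum>k<n. c\<^sub>3 j k * v k))\<^sup>2 else 0)"
        by (intro sum.cong refl) (auto simp: C3_def)
      also have "\<dots> \<le> t * (\<Sum>k<n. (cmod (v k))\<^sup>2)" unfolding cut[OF N(2)] by (rule a(6))
      finally show "(\<Sum>j<dim_row C3. (cmod (\<Sum>k<dim_col C3. C3 $$ (j, k) * v k))\<^sup>2)
          \<le> t * (\<Sum>k<dim_col C3. (cmod (v k))\<^sup>2)"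
        by (simp add: C3_def)
    qed
    have "{1..2 + 1::nat} = {1, 2, 3}" by auto
    then have "(\<Prod>i=1..2 + 1. mat_norm (C i)) = mat_norm C1 * (mat_norm C2 * mat_norm C3)"
      by (simp add: C_def)
    also have "\<dots> \<le> sqrt t * (sqrt 1 * sqrt t)"
      by (intro mult_mono m1 m2 m3 mult_nonneg_nonneg mat_norm_nonneg) (use t in auto)
    finally show ?thesis using t by simp
  qed
  ultimately show ?thesis by blast
qed

lemma row_factorisation:
  fixes X :: "'a::unital_cstar_algebra mat"
  assumes X: "X \<in> carrier_mat 1 n"
  shows "\<exists>N C D. is_factorisation 2 X N C D \<and> (\<Prod>i=1..2 + 1. mat_norm (C i)) \<le> 5 * mat_norm X"
  using factorisation_of_row_fact[OF X row_fact_bound] norm_row_le_mat_norm[OF X]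
  by (meson mult_left_mono order_trans zero_le_numeral)

section \<open>The numerical constant\<close>

text \<open>A uniform lower bound for the family, so the infimum is over a set bounded below and
  dominates the constant 5. The cubic is replaced by the linear bound \<open>4 * c - 1\<close>,
  valid since \<open>c \<ge> 2\<close>.\<close>

lemma constant_ge_5:
  assumes "c > sqrt 2 + 1"
  shows "5 \<le> sqrt 2 * (c ^ 3 - 1) / (c - sqrt 2 - 1)"
proof -
  have s: "1.4 \<le> sqrt 2" by (rule real_le_rsqrt) (simp add: power2_eq_square)
  have c: "c \<ge> 2" using assms s by simp
  have "2 * 2 \<le> c * c" using c by (intro mult_mono) auto
  then have "c * 4 \<le> c * (c * c)" using c by (intro mult_left_mono) auto
  then have "c ^ 3 - 1 \<ge> 4 * c - 1" by (simp add: power3_eq_cube mult.assoc)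
  then have "1.4 * (4 * c - 1) \<le> sqrt 2 * (c ^ 3 - 1)" using s c by (intro mult_mono) auto
  then have "5 * (c - sqrt 2 - 1) \<le> sqrt 2 * (c ^ 3 - 1)" using c s by simp
  then show ?thesis using assms by (simp add: pos_le_divide_eq)
qed

text \<open>7/2 is a convenient rational near the minimiser of the quotient, with value about
  54.5.\<close>

lemma constant_at_7_halves:
  "(7 / 2 :: real) > sqrt 2 + 1" "sqrt 2 * ((7 / 2) ^ 3 - 1) / (7 / 2 - sqrt 2 - 1) < 55"
proof -
  have s: "sqrt 2 < 1.4145" by (rule real_less_lsqrt) (auto simp: power2_eq_square)
  then show "(7 / 2 :: real) > sqrt 2 + 1" by simp
  have "sqrt 2 * ((7 / 2) ^ 3 - 1) < 55 * (7 / 2 - sqrt 2 - 1)" using s by (simp add: power3_eq_cube)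
  then show "sqrt 2 * ((7 / 2) ^ 3 - 1) / (7 / 2 - sqrt 2 - 1) < 55" using s
      by (simp add: pos_divide_less_eq)
qed

theorem theorem2p6:
  shows "row_length_at_most TYPE('a::unital_cstar_algebra) 2 \<and>
    (\<forall>n. \<forall>x \<in> (carrier_mat 1 n :: 'a mat set).
       fact_norm 2 x \<le> (INF c \<in> {c::real. c > sqrt 2 + 1}. sqrt 2 * (c ^ 3 - 1) / (c - sqrt 2 - 1)) * mat_norm x \<and>
       (x \<noteq> 0\<^sub>m 1 n \<longrightarrow>
          (INF c \<in> {c::real. c > sqrt 2 + 1}. sqrt 2 * (c ^ 3 - 1) / (c - sqrt 2 - 1)) * mat_norm x < 55 * mat_norm x))"
    (is "_ \<and> (\<forall>n. \<forall>x \<in> _ n. _ x \<le> ?K * _ x \<and> _ n x)")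
proof (intro conjI allI ballI impI)
  have "\<exists>N C D. is_factorisation 2 x N C D \<and> (\<Prod>i=1..2 + 1. mat_norm (C i)) \<le> 5 * mat_norm x"
    if "x \<in> carrier_mat 1 n" for n and x :: "'a mat"
    using row_factorisation[OF that] .
  then show "row_length_at_most TYPE('a) 2"
    unfolding row_length_at_most_def by (intro exI[of _ 5]) auto
next
  fix n and x :: "'a mat" assume x: "x \<in> carrier_mat 1 n"
  obtain N C D where f: "is_factorisation 2 x N C D" "(\<Prod>i=1..2 + 1. mat_norm (C i)) \<le> 5 * mat_norm x"
    using row_factorisation[OF x] by blast
  have "fact_norm 2 x \<le> (\<Prod>i=1..2 + 1. mat_norm (C i))"
    unfolding fact_norm_def
  proof (rule cInf_lower)
    show "bdd_below {\<Prod>i=1..2 + 1. mat_norm (C i) |N C D. is_factorisation 2 x N C D}"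
      by (rule bdd_belowI[of _ 0]) (auto intro!: prod_nonneg mat_norm_nonneg)
  qed (use f in blast)
  also note f(2)
  also have "5 * mat_norm x \<le> ?K * mat_norm x"
    using constant_at_7_halves(1)
    by (intro mult_right_mono mat_norm_nonneg cINF_greatest constant_ge_5) (blast, simp)
  finally show "fact_norm 2 x \<le> ?K * mat_norm x" .
next
  fix n and x :: "'a mat" assume x: "x \<in> carrier_mat 1 n" "x \<noteq> 0\<^sub>m 1 n"
  have "?K \<le> sqrt 2 * ((7 / 2) ^ 3 - 1) / (7 / 2 - sqrt 2 - 1)"
    using constant_at_7_halves(1) by (intro cINF_lower bdd_belowI2[of _ 5] constant_ge_5) auto
  also note constant_at_7_halves(2)
  finally show "?K * mat_norm x < 55 * mat_norm x"
    using mat_norm_pos[OF x] by (rule mult_strict_right_mono)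
qed

end
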